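(* Let $k\ge 2$ be a constant. There is a constant $\ell$ (one may take $\ell=k$) such that every deterministic $\mathsf{Online}$-$\mathsf{LOCAL}$ algorithm that properly colors every $n$-node connected graph in $\mathcal{L}_{k,\ell}$ using colors from $\{1,\dots,k+1\}$ has locality $\Omega(\log n)$.
   Context: A graph is $k$-partite if it admits a proper coloring with $k$ colors. For a graph $G=(V,E)$, $U\subseteq V$ and an integer $T\ge 0$, $\mathcal{B}(U,T)$ denotes the set of nodes at distance at most $T$ from some node of $U$, and $G[U]$ denotes the induced subgraph. Locally inferable unique colorings: let $G$ be a $k$-partite graph and $\ell\ge0$ an integer. For a connected subgraph $G'=(V',E')$ of $G$, let $\mathcal{C}^*(G',\ell)$ be the set of all proper $k$-colorings (colors $\{1,\dots,k\}$) of $G[\mathcal{B}(V',\ell)]$, and $\mathcal{C}(G',\ell)$ the set of restrictions to $V'$ of colorings in $\mathcal{C}^*(G',\ell)$. Two $k$-colorings $c,c'$ are identical up to a permutation if $c'=\phi\circ c$ for some permutation $\phi$ of $\{1,\dots,k\}$. $\mathcal{L}_{k,\ell}$ is the class of $k$-partite graphs $G$ such that for every connected subgraph $G'$ of $G$, all colorings in $\mathcal{C}(G',\ell)$ are identical up to a permutation. The $\mathsf{Online}$-$\mathsf{LOCAL}$ model: an algorithm with locality $T=T(n)$ is deterministic and knows $n$. The adversary chooses an $n$-node input graph $G=(V,E)$ from the input family, assigns distinct identifiers from $\{1,\dots,\mathrm{poly}(n)\}$ to its nodes, and chooses an ordering $\sigma=(v_1,\dots,v_n)$ of $V$. For $i=1,\dots,n$,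 when $v_i$ is presented, the algorithm must irrevocably assign an output (here a color) to $v_i$ as a function of the sequence $(v_1,\dots,v_i)$ and the induced subgraph $G_i=G\big[\bigcup_{j\le i}\mathcal{B}(v_j,T)\big]$ (with identifiers); thus the algorithm has global memory of everything seen so far. The algorithm solves a coloring problem on an input family if for every choice of the adversary the final coloring is proper and uses only the allowed colors. The locality of a problem is the minimum locality of an algorithm solving it. *)

theory Defs
  imports Complex_Main
begin

text \<open>Graphs: vertex set V (nodes are identified with their identifiers, natural
numbers), edge set E :: (nat \<times> nat) set, symmetric and irreflexive, E \<subseteq> V \<times> V.\<close>

definition graph :: "nat set \<Rightarrow> (nat \<times> nat) set \<Rightarrow> bool" where
  "graph V E \<longleftrightarrow> E \<subseteq> V \<times> V \<and> sym E \<and> irrefl E"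

definition connected_graph :: "nat set \<Rightarrow> (nat \<times> nat) set \<Rightarrow> bool" where
  "connected_graph V E \<longleftrightarrow> V \<noteq> {} \<and> (\<forall>u\<in>V. \<forall>v\<in>V. (u, v) \<in> (E \<union> E\<inverse>)\<^sup>*)"

text \<open>B(U,T): nodes at distance at most T from some node of U (for U \<subseteq> V).\<close>
definition ball :: "(nat \<times> nat) set \<Rightarrow> nat set \<Rightarrow> nat \<Rightarrow> nat set" where
  "ball E U T = {v. \<exists>u\<in>U. \<exists>m\<le>T. (u, v) \<in> E ^^ m}"

text \<open>Edge set of the induced subgraph G[S].\<close>
definition induced_edges :: "(nat \<times> nat) set \<Rightarrow> nat set \<Rightarrow> (nat \<times> nat) set" where
  "induced_edges E S = E \<inter> (S \<times> S)"

text \<open>Proper coloring of the graph (S, E[S]) with colors {1..k}.\<close>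
definition proper_coloring :: "nat \<Rightarrow> nat set \<Rightarrow> (nat \<times> nat) set \<Rightarrow> (nat \<Rightarrow> nat) \<Rightarrow> bool" where
  "proper_coloring k S E col \<longleftrightarrow>
     (\<forall>v\<in>S. col v \<in> {1..k}) \<and> (\<forall>(u, v)\<in>E. u \<in> S \<longrightarrow> v \<in> S \<longrightarrow> col u \<noteq> col v)"

definition k_partite :: "nat \<Rightarrow> nat set \<Rightarrow> (nat \<times> nat) set \<Rightarrow> bool" where
  "k_partite k V E \<longleftrightarrow> (\<exists>col. proper_coloring k V E col)"

text \<open>C(G',l): restrictions to V' of proper k-colorings of G[B(V',l)].
  Restrictions are compared on V' only.\<close>
definition locally_inferable :: "nat \<Rightarrow> nat \<Rightarrow> nat set \<Rightarrow> (nat \<times> nat) set \<Rightarrow> bool" where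
  "locally_inferable k l V E \<longleftrightarrow>
     graph V E \<and> k_partite k V E \<and>
     (\<forall>V' E'. V' \<subseteq> V \<and> E' \<subseteq> E \<inter> (V' \<times> V') \<and> connected_graph V' E' \<longrightarrow>
        (\<forall>c c'. proper_coloring k (ball E V' l) (induced_edges E (ball E V' l)) c \<and>
                proper_coloring k (ball E V' l) (induced_edges E (ball E V' l)) c' \<longrightarrow>
           (\<exists>\<phi>. bij_betw \<phi> {1..k} {1..k} \<and> (\<forall>v\<in>V'. c' v = \<phi> (c v)))))"

text \<open>Online-LOCAL. An algorithm (for fixed n and locality T) is a function of the
  sequence (v_1,...,v_i) of presented nodes and of the induced subgraph
  G_i = G[B({v_1..v_i},T)] (vertex set and edge set, with identifiers).
  Given an ordering vs of V, the color of vs!i is the output at step i+1.\<close>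
type_synonym online_alg = "nat list \<Rightarrow> nat set \<Rightarrow> (nat \<times> nat) set \<Rightarrow> nat"

definition online_output :: "online_alg \<Rightarrow> nat \<Rightarrow> (nat \<times> nat) set \<Rightarrow> nat list \<Rightarrow> nat \<Rightarrow> nat" where
  "online_output A T E vs i =
     (let pre = take (Suc i) vs; B = ball E (set pre) T in A pre B (induced_edges E B))"

text \<open>A solves (k+1)-coloring of the n-node connected graphs of L_{k,l}, where the
  identifiers come from {1..n^c}, for every choice of the adversary.\<close>
definition online_solves :: "nat \<Rightarrow> nat \<Rightarrow> nat \<Rightarrow> nat \<Rightarrow> nat \<Rightarrow> online_alg \<Rightarrow> bool" where
  "online_solves k l c n T A \<longleftrightarrow>
     (\<forall>V E vs. finite V \<and> card V = n \<and> V \<subseteq> {1..n ^ c} \<and> connected_graph V E \<and>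
         locally_inferable k l V E \<and> distinct vs \<and> set vs = V \<longrightarrow>
        (\<forall>i<n. online_output A T E vs i \<in> {1..k+1}) \<and>
        (\<forall>i<n. \<forall>j<n. (vs ! i, vs ! j) \<in> E \<longrightarrow> online_output A T E vs i \<noteq> online_output A T E vs j))"

end

theory Submission
  imports Defs "HOL-Combinatorics.Transposition"
begin

text \<open>
  \<^bold>\<open>Two colors.\<close> In a properly 3-colored bipartite graph, the sum of the color increments
  (\<open>\<plusminus>1\<close> modulo 3) along a path, its drift, vanishes on closed walks of length four, so
  moving a path across a ladder changes its drift by at most 2. Against an algorithm with locality \<open>T\<close> one forces a path
  of drift at least \<open>m\<close> with \<open>O(2\<^sup>m T)\<close> nodes: take two paths of drift \<open>m\<close>, which the
  algorithm has to color without seeing their connection, and link them by a gap whose length has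
  the parity that rules out the drift \<open>-m\<close>; then either the whole path or the reversed gap has
  drift at least \<open>m + 1\<close>. The path is the bottom row of a grid of height \<open>T + 2\<close>
  whose top row is collapsed, invisibly for the algorithm, to a single edge. This bounds the
  drift by \<open>2 T + 5\<close>; hence \<open>n\<close> is at most exponential in \<open>T\<close>.

  \<^bold>\<open>More colors.\<close> Join to every closed neighborhood of a graph a new node (its twin). When all
  edges lie in \<open>k\<close>-cliques, local uniqueness of the \<open>k\<close>-coloring passes to the
  \<open>(k + 1)\<close>-colorings of the larger graph, in which all twins have the same color. Conversely a
  \<open>(k + 2)\<close>-coloring of the larger graph gives a \<open>(k + 1)\<close>-coloring of the original one:
  a node whose color is \<open>k + 2\<close> takes the color of its twin. So an algorithm for
  \<open>k + 1\<close> yields one for \<open>k\<close> with locality \<open>T + 1\<close> on half as many nodes.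
\<close>

section \<open>Views and paths\<close>

lemma ball_refl: "u \<in> U \<Longrightarrow> u \<in> ball E U T"
  unfolding ball_def by (auto intro!: bexI[of _ u] exI[of _ 0])

lemma ball_Suc: "u \<in> ball E U T \<Longrightarrow> (u, v) \<in> E \<Longrightarrow> v \<in> ball E U (Suc T)"
  unfolding ball_def by (auto intro: relpow_Suc_I)

lemma ball_mono: "U \<subseteq> U' \<Longrightarrow> T \<le> T' \<Longrightarrow> ball E U T \<subseteq> ball E U' T'"
  unfolding ball_def by (blast intro: le_trans)

text \<open>Every step of a walk of length at most \<open>T\<close> from \<open>U\<close> starts
  inside the ball of \<open>E\<close>, where the two edge sets agree. Hence nothing has to be known
  in advance about the ball of \<open>E'\<close>.\<close>

lemma relpow_agree:
  assumes "\<And>u v. u \<in> ball E U T \<Longrightarrow> (u, v) \<in> E \<longleftrightarrow> (u, v) \<in> E'" "u \<in> U" "m \<le> T"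
  shows "(u, v) \<in> E ^^ m \<longleftrightarrow> (u, v) \<in> E' ^^ m"
  using assms(3)
proof (induction m arbitrary: v)
  case (Suc m)
  have "(w, v) \<in> E \<longleftrightarrow> (w, v) \<in> E'" if "(u, w) \<in> E ^^ m" for w
  proof -
    have "w \<in> ball E U T" using that assms(2) Suc.prems Suc_leD unfolding ball_def by blast
    then show ?thesis by (rule assms(1))
  qed
  then show ?case using Suc by (auto simp: relcomp_unfold)
qed simp

lemma ball_agree:
  assumes "\<And>u v. u \<in> ball E U T \<Longrightarrow> (u, v) \<in> E \<longleftrightarrow> (u, v) \<in> E'"
  shows "ball E' U T = ball E U T"
  using relpow_agree[OF assms] unfolding ball_def by blast

definition run :: "online_alg \<Rightarrow> nat \<Rightarrow> (nat \<times> nat) set \<Rightarrow> nat list \<Rightarrow> nat" where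
  "run A T E vs = A vs (ball E (set vs) T) (induced_edges E (ball E (set vs) T))"

lemma run_agree:
  assumes "\<And>u v. u \<in> ball E (set vs) T \<Longrightarrow> (u, v) \<in> E \<longleftrightarrow> (u, v) \<in> E'"
  shows "run A T E' vs = run A T E vs"
proof -
  have "induced_edges E' (ball E (set vs) T) = induced_edges E (ball E (set vs) T)"
    using assms unfolding induced_edges_def by auto
  moreover have "ball E' (set vs) T = ball E (set vs) T" using assms by (rule ball_agree)
  ultimately show ?thesis unfolding run_def by simp
qed

text \<open>Colors are indexed by nodes instead of positions. \<open>F\<close> is arbitrary, so the
  same notion serves for an algorithm on a graph and for the game on a path of columns that is
  derived from it.\<close>

definition play :: "('r \<Rightarrow> nat list \<Rightarrow> nat) \<Rightarrow> 'r \<Rightarrow> nat list \<Rightarrow> nat \<Rightarrow> nat" where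
  "play F R vs v = F R (takeWhile (\<lambda>w. w \<noteq> v) vs @ [v])"

lemma online_output_eq_play:
  assumes "distinct vs" "i < length vs"
  shows "online_output A T E vs i = play (run A T) E vs (vs ! i)"
proof -
  have "takeWhile (\<lambda>w. w \<noteq> vs ! i) vs = take i vs"
    using assms by (intro takeWhile_eq_take_P_nth) (auto simp: nth_eq_iff_index_eq)
  then show ?thesis using assms
    unfolding online_output_def play_def run_def Let_def by (simp add: take_Suc_conv_app_nth)
qed

section \<open>Paths given by lists of nodes\<close>

fun line :: "'a list \<Rightarrow> ('a \<times> 'a) set" where
  "line (x # y # zs) = {(x, y), (y, x)} \<union> line (y # zs)"
| "line _ = {}"

lemma line_subset: "line xs \<subseteq> set xs \<times> set xs"
  by (induction xs rule: line.induct) auto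

lemma sym_line: "(x, y) \<in> line xs \<Longrightarrow> (y, x) \<in> line xs"
  by (induction xs rule: line.induct) auto

lemma line_append:
  "xs \<noteq> [] \<Longrightarrow> ys \<noteq> [] \<Longrightarrow>
    line (xs @ ys) = line xs \<union> line ys \<union> {(last xs, hd ys), (hd ys, last xs)}"
proof (induction xs rule: line.induct)
  case ("2_2" x)
  then show ?case by (cases ys) auto
qed auto

lemma line_rev: "line (rev xs) = line xs"
proof (induction xs rule: line.induct)
  case (1 x y zs)
  then show ?case using line_append[of "rev (y # zs)" "[x]"] by (auto simp: last_rev)
qed auto

lemma line_append_subset: "line xs \<subseteq> line (ys @ xs @ zs)"
proof -
  have 1: "line a \<subseteq> line (a @ b)" "line b \<subseteq> line (a @ b)" for a b :: "'a list"
    by (cases "a = []"; cases "b = []"; auto simp: line_append)+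
  show ?thesis using 1 by blast
qed

lemma line_inner:
  assumes "distinct (xs @ ys @ zs)" "t \<in> set ys" "t \<noteq> hd ys" "t \<noteq> last ys"
  shows "(t, v) \<in> line (xs @ ys @ zs) \<longleftrightarrow> (t, v) \<in> line ys"
proof -
  have ne: "ys \<noteq> []" using assms by auto
  have t: "t \<notin> set xs" "t \<notin> set zs" using assms by auto
  have 1: "(t, v) \<in> line (ys @ zs) \<longleftrightarrow> (t, v) \<in> line ys"
  proof (cases "zs = []")
    case False
    then have "t \<noteq> hd zs" using t by (metis list.set_sel(1))
    then show ?thesis using False ne t assms line_subset[of zs] by (auto simp: line_append)
  qed simp
  show ?thesis
  proof (cases "xs = []")
    case False
    then have "t \<noteq> last xs" using t by (metis last_in_set)
    then show ?thesis using False ne t assms line_subset[of xs] 1 by (auto simp: line_append)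
  qed (use 1 in simp)
qed

lemma line_step_inner:
  assumes "distinct (xs @ a # ys @ b # zs)" "t \<in> set ys" "(t, v) \<in> line (xs @ a # ys @ b # zs)"
  shows "v \<in> set (a # ys @ [b])"
proof -
  have "(t, v) \<in> line (a # ys @ [b])"
    using line_inner[of xs "a # ys @ [b]" zs t v] assms by auto
  then show ?thesis using line_subset by fastforce
qed

text \<open>A step widens the segment by at most one node on each side, so the induction moves one
  node of \<open>xs\<close> and one of \<open>zs\<close> into \<open>ys\<close>. The margins have
  more than \<open>m\<close> nodes, so the ends of the path stay out of reach; no edge of
  \<open>R\<close> leaves a node of the path.\<close>

lemma line_walk_inner:
  assumes "distinct (xs @ ys @ zs)" "m < length xs" "m < length zs" "t \<in> set ys"
    and "\<And>u v. (u, v) \<in> R \<Longrightarrow> u \<notin> set (xs @ ys @ zs)"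
    and "(t, v) \<in> (R \<union> line (xs @ ys @ zs)) ^^ m"
  shows "v \<in> set (xs @ ys @ zs) \<and> v \<noteq> hd (xs @ ys @ zs) \<and> v \<noteq> last (xs @ ys @ zs)"
  using assms
proof (induction m arbitrary: xs ys zs t)
  case 0
  then show ?case by (cases xs; cases zs rule: rev_cases) auto
next
  case (Suc m)
  obtain xs' a where xs: "xs = xs' @ [a]" using Suc.prems(2) by (cases xs rule: rev_cases) auto
  obtain b zs' where zs: "zs = b # zs'" using Suc.prems(3) by (cases zs) auto
  have L: "xs @ ys @ zs = xs' @ (a # ys @ [b]) @ zs'" unfolding xs zs by simp
  obtain t' where t': "(t, t') \<in> R \<union> line (xs @ ys @ zs)" "(t', v) \<in> (R \<union> line (xs @ ys @ zs)) ^^ m"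
    using Suc.prems(6) by (meson relpow_Suc_D2)
  have "(t, t') \<in> line (xs @ ys @ zs)" using t'(1) Suc.prems(4,5) by auto
  then have "t' \<in> set (a # ys @ [b])"
    using line_step_inner[of xs' a ys b zs' t t'] Suc.prems(1,4) unfolding xs zs by simp
  from Suc.IH[of xs' "a # ys @ [b]" zs', folded L, OF _ _ _ this] t'(2) Suc.prems
  show ?case unfolding xs zs by auto
qed

lemma line_bipartite: "distinct xs \<Longrightarrow> \<exists>q :: 'a \<Rightarrow> bool. \<forall>x y. (x, y) \<in> line xs \<longrightarrow> q x \<noteq> q y"
proof (induction xs rule: line.induct)
  case (1 x y zs)
  then obtain q :: "'a \<Rightarrow> bool" where q: "\<And>a b. (a, b) \<in> line (y # zs) \<Longrightarrow> q a \<noteq> q b" by auto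
  have "a \<noteq> x \<and> b \<noteq> x" if "(a, b) \<in> line (y # zs)" for a b
    using that line_subset[of "y # zs"] 1(2) by auto
  then have "(q(x := \<not> q y)) a \<noteq> (q(x := \<not> q y)) b" if "(a, b) \<in> line (x # y # zs)" for a b
    using that q[of a b] 1(2) by auto
  then show ?case by blast
qed auto

text \<open>A coloring with three colors gives every edge the sign of the color increment modulo 3.
  On edges that are not properly colored the sign is arbitrary, but kept antisymmetric.\<close>

definition turn :: "(nat \<Rightarrow> nat) \<Rightarrow> nat \<Rightarrow> nat \<Rightarrow> int" where
  "turn c x y =
    (if c y = c x + 1 \<or> c x = c y + 2 then 1
     else if c x = c y + 1 \<or> c y = c x + 2 then -1
     else if x < y then 1 else -1)"

lemma turn_antisym: "x \<noteq> y \<Longrightarrow> turn c y x = - turn c x y"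
  unfolding turn_def by auto

fun drift :: "(nat \<Rightarrow> nat) \<Rightarrow> nat list \<Rightarrow> int" where
  "drift c (x # y # zs) = turn c x y + drift c (y # zs)"
| "drift c _ = 0"

lemma drift_append: "drift c (xs @ x # ys) = drift c (xs @ [x]) + drift c (x # ys)"
  by (induction c xs rule: drift.induct) (cases ys; simp)+

lemma drift_rev: "distinct xs \<Longrightarrow> drift c (rev xs) = - drift c xs"
proof (induction c xs rule: drift.induct)
  case (1 c x y zs)
  have "drift c (rev (x # y # zs)) = drift c (rev zs @ [y]) + drift c [y, x]"
    using drift_append[of c "rev zs" y "[x]"] by simp
  then show ?case using 1 turn_antisym[of x y c] by simp
qed auto

text \<open>Every step contributes 1 or -1, even on a badly colored edge, so the parity depends on
  the number of steps alone.\<close>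

lemma even_drift: "xs \<noteq> [] \<Longrightarrow> even (drift c xs) \<longleftrightarrow> odd (length xs)"
  by (induction c xs rule: drift.induct) (auto simp: turn_def)

lemma drift_cong: "(\<And>x. x \<in> set xs \<Longrightarrow> c x = c' x) \<Longrightarrow> drift c xs = drift c' xs"
  by (induction c xs rule: drift.induct) (auto simp: turn_def)

section \<open>Forcing a large drift\<close>

text \<open>This abstracts an algorithm that colors a path of columns: the answer depends only on
  the edges within reach. The bound \<open>N\<close> keeps smaller numbers free for a path that is
  already built into \<open>F\<close>.\<close>

definition local_above :: "nat \<Rightarrow> nat \<Rightarrow> ((nat \<times> nat) set \<Rightarrow> nat list \<Rightarrow> nat) \<Rightarrow> bool" where
  "local_above T N F \<longleftrightarrow>
     (\<forall>R R' vs. R \<subseteq> {N..} \<times> {N..} \<and> R' \<subseteq> {N..} \<times> {N..} \<and> set vs \<subseteq> {N..} \<and>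
        (\<forall>u\<in>ball R (set vs) T. \<forall>v. (u, v) \<in> R \<longleftrightarrow> (u, v) \<in> R') \<longrightarrow> F R vs = F R' vs)"

lemma local_aboveD:
  assumes "local_above T N F" "R \<subseteq> {N..} \<times> {N..}" "R' \<subseteq> {N..} \<times> {N..}" "set vs \<subseteq> {N..}"
    and "\<And>u v. u \<in> ball R (set vs) T \<Longrightarrow> (u, v) \<in> R \<longleftrightarrow> (u, v) \<in> R'"
  shows "F R vs = F R' vs"
  using assms unfolding local_above_def by simp

text \<open>The base value is one presented column with a margin of \<open>T + 1\<close> columns on
  either side. The recursion pays for two paths and for one spare column that adjusts the parity of
  the gap.\<close>

fun len :: "nat \<Rightarrow> nat \<Rightarrow> nat" where
  "len T 0 = 2 * T + 3"
| "len T (Suc m) = 2 * len T m + 1"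

text \<open>The columns in \<open>L\<close> form a path; the columns in \<open>ws\<close>, presented in this order, occupy a
  segment of it at distance more than \<open>T\<close> from both ends, so the path can still be reversed
  or extended at its ends without any effect on the colors given so far.\<close>

definition forced ::
  "nat \<Rightarrow> nat \<Rightarrow> nat \<Rightarrow> nat list \<Rightarrow> nat list \<Rightarrow> nat list \<Rightarrow> nat list \<Rightarrow> nat list \<Rightarrow> nat list \<Rightarrow> bool" where
  "forced T N k pre a mid b post ws \<longleftrightarrow>
     distinct (pre @ a @ mid @ b @ post) \<and> set (pre @ a @ mid @ b @ post) = {N..<N + k} \<and>
     T < length pre \<and> T < length post \<and> mid \<noteq> [] \<and>
     distinct ws \<and> set ws = set (a @ mid @ b)"

lemma forced_rev:
  assumes "forced T N k pre a mid b post ws"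
  shows "forced T N k (rev post) (rev b) (rev mid) (rev a) (rev pre) ws"
  using assms unfolding forced_def by auto

lemma play_agree:
  assumes "local_above T N F" "R \<subseteq> {N..} \<times> {N..}" "R' \<subseteq> {N..} \<times> {N..}" "set vs \<subseteq> {N..}" "t \<in> set vs"
    and "\<And>u v. u \<in> ball R (set vs) T \<Longrightarrow> (u, v) \<in> R \<longleftrightarrow> (u, v) \<in> R'"
  shows "play F R vs t = play F R' vs t"
proof -
  let ?vs = "takeWhile (\<lambda>w. w \<noteq> t) vs @ [t]"
  have sub: "set ?vs \<subseteq> set vs" using assms(5) set_takeWhileD by fastforce
  then have "ball R (set ?vs) T \<subseteq> ball R (set vs) T" by (intro ball_mono) auto
  then have "F R ?vs = F R' ?vs"
    by (intro local_aboveD[OF assms(1-3)]) (use assms(4,6) sub in \<open>simp_all add: subset_iff\<close>)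
  then show ?thesis unfolding play_def .
qed

lemma play_append1: "t \<in> set vs \<Longrightarrow> play F R (vs @ ws) t = play F R vs t"
  unfolding play_def by (simp add: takeWhile_append1)

text \<open>This turns the continuation of a game into a fresh game against an algorithm that has
  the history \<open>vs\<close> built in.\<close>

lemma play_append2: "t \<notin> set vs \<Longrightarrow> play F R (vs @ ws) t = play (\<lambda>R ws. F R (vs @ ws)) R ws t"
  unfolding play_def by (subst takeWhile_append2) auto

text \<open>Among the two pieces and the gap between them, the only obstruction to a larger drift is a gap
  whose drift is exactly \<open>-m\<close>; it is excluded by the parity of its length.\<close>

lemma drift_merge:
  assumes "int m \<le> drift c x" "int m \<le> drift c y" "x \<noteq> []" "y \<noteq> []"
    and "even (length h) \<longleftrightarrow> even m"
  shows "int (Suc m) \<le> drift c (x @ h @ y) \<or> drift c (last x # h @ [hd y]) \<le> - int (Suc m)"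
proof -
  obtain x' p where x: "x = x' @ [p]" using assms(3) by (cases x rule: rev_cases) auto
  obtain q y' where y: "y = q # y'" using assms(4) by (cases y) auto
  have "drift c (x @ h @ y) = drift c x + drift c (p # h @ q # y')"
    using drift_append[of c x' p "h @ y"] unfolding x y by simp
  moreover have "drift c ((p # h) @ q # y') = drift c ((p # h) @ [q]) + drift c y"
    unfolding y by (rule drift_append)
  moreover have "even (drift c (p # h @ [q])) \<longleftrightarrow> odd m"
    using even_drift[of "p # h @ [q]" c] assms(5) by simp
  then have "drift c (p # h @ [q]) \<noteq> - int m" by auto
  ultimately show ?thesis using assms(1,2) unfolding x y by auto
qed

text \<open>The coloring need not be proper here, because \<open>turn\<close> is always 1 or -1. The
  induction runs over all \<open>F\<close> and \<open>N\<close>, since the second path is forced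
  from an algorithm that has already answered on the first.\<close>

lemma forcing:
  assumes "local_above T N F"
  shows "\<exists>pre a mid b post ws. forced T N (len T m) pre a mid b post ws \<and>
    int m \<le> drift (play F (line (pre @ a @ mid @ b @ post)) ws) mid"
  using assms
proof (induction m arbitrary: F N)
  case 0
  have "forced T N (len T 0) [N..<N + Suc T] [] [N + Suc T] [] [N + T + 2..<N + (2 * T + 3)] [N + Suc T]"
    unfolding forced_def by auto
  then have "forced T N (len T 0) [N..<N + Suc T] [] [N + Suc T] [] [N + T + 2..<N + (2 * T + 3)] [N + Suc T] \<and>
    int 0 \<le> drift (play F (line ([N..<N + Suc T] @ [] @ [N + Suc T] @ [] @ [N + T + 2..<N + (2 * T + 3)])) [N + Suc T])
      [N + Suc T]"
    by simp
  then show ?case by blast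
next
  case (Suc m)
  obtain pre1 a1 mid1 b1 post1 ws1 where f1: "forced T N (len T m) pre1 a1 mid1 b1 post1 ws1"
    and d1: "int m \<le> drift (play F (line (pre1 @ a1 @ mid1 @ b1 @ post1)) ws1) mid1"
    using Suc.IH[OF Suc.prems] by blast
  define L1 where "L1 = pre1 @ a1 @ mid1 @ b1 @ post1"
  define N2 where "N2 = N + len T m"
  \<comment> \<open>\<open>F2\<close> answers on the columns from \<open>N2\<close> on, while the
    first path, already presented, is a separate component.\<close>
  define F2 where "F2 = (\<lambda>R ws. F (line L1 \<union> R) (ws1 @ ws))"
  have L1: "distinct L1" "set L1 = {N..<N2}" "set ws1 \<subseteq> set L1" "distinct ws1" "set ws1 = set (a1 @ mid1 @ b1)"
    "T < length pre1" "T < length post1" "mid1 \<noteq> []"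
    using f1 unfolding forced_def L1_def N2_def by auto
  have lineL1: "line L1 \<subseteq> {N..<N2} \<times> {N..<N2}" using line_subset[of L1] L1(2) by simp
  have "local_above T N2 F2"
    unfolding local_above_def F2_def
  proof (intro allI impI)
    fix R R' :: "(nat \<times> nat) set" and vs
    assume A: "R \<subseteq> {N2..} \<times> {N2..} \<and> R' \<subseteq> {N2..} \<times> {N2..} \<and> set vs \<subseteq> {N2..} \<and>
      (\<forall>u\<in>ball R (set vs) T. \<forall>v. (u, v) \<in> R \<longleftrightarrow> (u, v) \<in> R')"
    \<comment> \<open>No walk passes between the two components, so the view of the new one is
      determined by \<open>R\<close> alone.\<close>
    have walk: "(u \<in> {N2..} \<longrightarrow> v \<in> {N2..} \<and> (u, v) \<in> R ^^ j) \<and> (u \<in> {N..<N2} \<longrightarrow> v \<in> {N..<N2})"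
      if "(u, v) \<in> (line L1 \<union> R) ^^ j" for j u v
      using that
    proof (induction j arbitrary: v)
      case (Suc j)
      then obtain w where w: "(u, w) \<in> (line L1 \<union> R) ^^ j" "(w, v) \<in> line L1 \<union> R" by auto
      have "w \<in> {N2..} \<longrightarrow> (w, v) \<in> R \<and> v \<in> {N2..}" "w \<in> {N..<N2} \<longrightarrow> v \<in> {N..<N2}"
        using w(2) lineL1 A by auto
      then show ?case using Suc.IH[OF w(1)] by auto
    qed simp
    have "line L1 \<union> R \<subseteq> {N..} \<times> {N..}" "line L1 \<union> R' \<subseteq> {N..} \<times> {N..}" "set (ws1 @ vs) \<subseteq> {N..}"
      using lineL1 L1 A unfolding N2_def by fastforce+
    moreover have "(u, v) \<in> line L1 \<union> R \<longleftrightarrow> (u, v) \<in> line L1 \<union> R'"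
      if u: "u \<in> ball (line L1 \<union> R) (set (ws1 @ vs)) T" for u v
    proof -
      obtain w j where w: "w \<in> set (ws1 @ vs)" "j \<le> T" "(w, u) \<in> (line L1 \<union> R) ^^ j"
        using u unfolding ball_def by auto
      consider "w \<in> set ws1" | "w \<in> set vs" using w(1) by auto
      then show ?thesis
      proof cases
        case 1
        then have "u \<in> {N..<N2}" using walk[OF w(3)] L1 by auto
        then show ?thesis using A by auto
      next
        case 2
        then have "w \<in> {N2..}" using A by auto
        then have "(w, u) \<in> R ^^ j" using walk[OF w(3)] by auto
        then have "u \<in> ball R (set vs) T" using 2 w(2) unfolding ball_def by auto
        then show ?thesis using A by auto
      qed
    qed
    ultimately show "F (line L1 \<union> R) (ws1 @ vs) = F (line L1 \<union> R') (ws1 @ vs)"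
      by (rule local_aboveD[OF Suc.prems])
  qed
  from Suc.IH[OF this] obtain pre2 a2 mid2 b2 post2 ws2
    where f2: "forced T N2 (len T m) pre2 a2 mid2 b2 post2 ws2"
    and d2: "int m \<le> drift (play F2 (line (pre2 @ a2 @ mid2 @ b2 @ post2)) ws2) mid2"
    by blast
  define L2 where "L2 = pre2 @ a2 @ mid2 @ b2 @ post2"
  define z where "z = N2 + len T m"
  have L2: "distinct L2" "set L2 = {N2..<z}" "set ws2 \<subseteq> set L2" "distinct ws2" "set ws2 = set (a2 @ mid2 @ b2)"
    "T < length pre2" "T < length post2" "mid2 \<noteq> []"
    using f2 unfolding forced_def L2_def z_def by auto
  have lineL2: "line L2 \<subseteq> {N2..<z} \<times> {N2..<z}" using line_subset[of L2] L2(2) by simp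
  \<comment> \<open>The spare column \<open>z\<close> enters the gap if the parity of its length has
    to be corrected, and extends the far end otherwise; the total length is the same in both
    cases.\<close>
  obtain g0 e where g0e: "g0 = [z] \<and> e = [] \<or> g0 = [] \<and> e = [z]"
    and par: "even (length (b1 @ (post1 @ g0 @ pre2) @ a2)) \<longleftrightarrow> even m"
  proof (cases "even (length (b1 @ post1 @ pre2 @ a2)) \<longleftrightarrow> even m")
    case True
    show ?thesis by (rule that[of "[]" "[z]"]) (use True in auto)
  next
    case False
    show ?thesis by (rule that[of "[z]" "[]"]) (use False in auto)
  qed
  define g where "g = post1 @ g0 @ pre2"
  define h where "h = b1 @ g @ a2"
  define L where "L = L1 @ g0 @ L2 @ e"
  \<comment> \<open>The gap comes last: \<open>mid1\<close> and \<open>mid2\<close> must be colored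
    before their link becomes visible.\<close>
  define ws where "ws = ws1 @ ws2 @ g"
  define c where "c = play F (line L) ws"
  have z: "N2 \<le> z" "N \<le> N2" unfolding z_def N2_def by auto
  have L: "distinct L" "set L = {N..<N + len T (Suc m)}"
  proof -
    have "z \<notin> set L1" "z \<notin> set L2" "set L1 \<inter> set L2 = {}" unfolding L1 L2 using z by auto
    then show "distinct L" using L1(1) L2(1) g0e unfolding L_def by auto
    have "set L = {N..<N2} \<union> {N2..<z} \<union> {z}" using L1(2) L2(2) g0e unfolding L_def by auto
    also have "\<dots> = {N..<Suc z}" using z by auto
    also have "Suc z = N + len T (Suc m)" unfolding z_def N2_def by simp
    finally show "set L = {N..<N + len T (Suc m)}" .
  qed
  have Leq: "L = pre1 @ a1 @ (mid1 @ h @ mid2) @ b2 @ (post2 @ e)"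
    unfolding L_def L1_def L2_def h_def g_def by simp
  have sub: "line L \<subseteq> {N..} \<times> {N..}" "line L1 \<subseteq> {N..} \<times> {N..}" "line L1 \<union> line L2 \<subseteq> {N..} \<times> {N..}"
    using line_subset[of L] L(2) lineL1 lineL2 z by fastforce+
  have inner1: "(u, v) \<in> line L1 \<longleftrightarrow> (u, v) \<in> line L" if "u \<in> set L1" "u \<noteq> hd L1" "u \<noteq> last L1" for u v
    using line_inner[of "[]" L1 "g0 @ L2 @ e" u v] L(1) that unfolding L_def by simp
  have inner2: "(u, v) \<in> line L2 \<longleftrightarrow> (u, v) \<in> line L" if "u \<in> set L2" "u \<noteq> hd L2" "u \<noteq> last L2" for u v
    using line_inner[of "L1 @ g0" L2 e u v] L(1) that unfolding L_def by simp
  have disj: "u \<notin> set L2" if "u \<in> set L1" for u using that L1(2) L2(2) by auto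
  have pos1: "u \<in> set L1 \<and> u \<noteq> hd L1 \<and> u \<noteq> last L1"
    if "w \<in> set ws1" "j \<le> T" "(w, u) \<in> (R \<union> line L1) ^^ j" "\<And>u v. (u, v) \<in> R \<Longrightarrow> u \<notin> set L1" for w u j R
  proof -
    have "pre1 @ (a1 @ mid1 @ b1) @ post1 = L1" unfolding L1_def by simp
    from line_walk_inner[of pre1 "a1 @ mid1 @ b1" post1 j w R u, unfolded this] show ?thesis
      using that L1(1,5-7) by auto
  qed
  have pos2: "u \<in> set L2 \<and> u \<noteq> hd L2 \<and> u \<noteq> last L2"
    if "w \<in> set ws2" "j \<le> T" "(w, u) \<in> (R \<union> line L2) ^^ j" "\<And>u v. (u, v) \<in> R \<Longrightarrow> u \<notin> set L2" for w u j R
  proof -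
    have "pre2 @ (a2 @ mid2 @ b2) @ post2 = L2" unfolding L2_def by simp
    from line_walk_inner[of pre2 "a2 @ mid2 @ b2" post2 j w R u, unfolded this] show ?thesis
      using that L2(1,5-7) by auto
  qed
  \<comment> \<open>Linking adds edges only at the ends of \<open>L1\<close> and \<open>L2\<close>,
    and these ends are outside the view of the presented columns. So the colors given on the
    separate paths remain valid.\<close>
  have c1: "play F (line L1) ws1 t = c t" if "t \<in> set mid1" for t
  proof -
    have t: "t \<in> set ws1" using that L1 by auto
    have "play F (line L1) ws1 t = play F (line L) ws1 t"
    proof (rule play_agree[OF Suc.prems sub(2,1) _ t])
      show "set ws1 \<subseteq> {N..}" using L1 by auto
      fix u v assume "u \<in> ball (line L1) (set ws1) T"
      then have "u \<in> set L1 \<and> u \<noteq> hd L1 \<and> u \<noteq> last L1"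
        using pos1[where R="{}"] unfolding ball_def by auto
      then show "(u, v) \<in> line L1 \<longleftrightarrow> (u, v) \<in> line L" using inner1 by blast
    qed
    then show ?thesis unfolding c_def ws_def by (simp add: play_append1[OF t])
  qed
  have c2: "play F2 (line L2) ws2 t = c t" if "t \<in> set mid2" for t
  proof -
    have t: "t \<in> set ws2" using that L2 by auto
    have t1: "t \<notin> set ws1" using t L1 L2 disj by blast
    have "play F2 (line L2) ws2 t = play F (line L1 \<union> line L2) (ws1 @ ws2) t"
      using play_append2[OF t1, of F "line L1 \<union> line L2" ws2] unfolding F2_def play_def by simp
    also have "\<dots> = play F (line L) (ws1 @ ws2) t"
    proof (rule play_agree[OF Suc.prems sub(3,1)])
      show "set (ws1 @ ws2) \<subseteq> {N..}" using L1 L2 z by auto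
      show "t \<in> set (ws1 @ ws2)" using t by simp
      fix u v assume "u \<in> ball (line L1 \<union> line L2) (set (ws1 @ ws2)) T"
      then obtain w j where w: "w \<in> set (ws1 @ ws2)" "j \<le> T" "(w, u) \<in> (line L1 \<union> line L2) ^^ j"
        unfolding ball_def by auto
      consider "w \<in> set ws1" | "w \<in> set ws2" using w(1) by auto
      then show "(u, v) \<in> line L1 \<union> line L2 \<longleftrightarrow> (u, v) \<in> line L"
      proof cases
        case 1
        have "u \<in> set L1 \<and> u \<noteq> hd L1 \<and> u \<noteq> last L1"
          by (rule pos1[of w j u "line L2"])
            (use 1 w disj line_subset[of L2] in \<open>auto simp: Un_commute\<close>)
        then show ?thesis using inner1 disj line_subset[of L2] by blast
      next
        case 2
        have "u \<in> set L2 \<and> u \<noteq> hd L2 \<and> u \<noteq> last L2"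
          by (rule pos2[of w j u "line L1"]) (use 2 w disj line_subset[of L1] in auto)
        then show ?thesis using inner2 disj line_subset[of L1] by blast
      qed
    qed
    also have "\<dots> = c t" using play_append1[of t "ws1 @ ws2" F "line L" g] t unfolding c_def ws_def by simp
    finally show ?thesis .
  qed
  have "int m \<le> drift c mid1" "int m \<le> drift c mid2"
    using d1 d2 drift_cong[of mid1, OF c1] drift_cong[of mid2, OF c2] unfolding L1_def L2_def by simp_all
  moreover have "even (length h) \<longleftrightarrow> even m" using par unfolding h_def g_def by simp
  ultimately consider
    (total) "int (Suc m) \<le> drift c (mid1 @ h @ mid2)"
    | (gap) "drift c (last mid1 # h @ [hd mid2]) \<le> - int (Suc m)"
    using drift_merge L1(8) L2(8) by blast
  then show ?case
  proof cases
    case total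
    have "forced T N (len T (Suc m)) pre1 a1 (mid1 @ h @ mid2) b2 (post2 @ e) ws"
      unfolding forced_def Leq[symmetric]
    proof (intro conjI L)
      show "distinct ws" "set ws = set (a1 @ (mid1 @ h @ mid2) @ b2)"
        using L(1) L1 L2 unfolding Leq ws_def h_def g_def by auto
    qed (use L1 L2 in auto)
    then show ?thesis using total unfolding c_def Leq by blast
  next
    case gap
    \<comment> \<open>Now only the gap and the two columns next to it are measured; the rest of
      \<open>mid1\<close> and \<open>mid2\<close> joins the columns that are presented but not
      counted. Reversing the path makes the drift positive.\<close>
    define mid where "mid = last mid1 # h @ [hd mid2]"
    define a where "a = a1 @ butlast mid1"
    define b where "b = tl mid2 @ b2"
    have Leq': "L = pre1 @ a @ mid @ b @ (post2 @ e)"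
      unfolding Leq a_def b_def mid_def using L1(8) L2(8) by simp
    have "set (a @ mid @ b) = set (a1 @ mid1 @ h @ mid2 @ b2)"
    proof -
      have "a @ mid @ b = a1 @ (butlast mid1 @ [last mid1]) @ h @ (hd mid2 # tl mid2) @ b2"
        unfolding a_def b_def mid_def by simp
      then show ?thesis using L1(8) L2(8) by simp
    qed
    then have "set ws = set (a @ mid @ b)" unfolding ws_def h_def g_def using L1(5) L2(5) by auto
    moreover have "distinct ws" using L(1) L1 L2 unfolding Leq ws_def h_def g_def by auto
    ultimately have "forced T N (len T (Suc m)) pre1 a mid b (post2 @ e) ws"
      unfolding forced_def Leq'[symmetric] using L L1 L2 by (auto simp: mid_def)
    then have "forced T N (len T (Suc m)) (rev (post2 @ e)) (rev b) (rev mid) (rev a) (rev pre1) ws"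
      by (rule forced_rev)
    moreover have "int (Suc m) \<le> drift c (rev mid)"
      using gap drift_rev[of mid c] L(1) unfolding Leq' mid_def by auto
    moreover have "line (rev (post2 @ e) @ rev b @ rev mid @ rev a @ rev pre1) = line L"
      using line_rev[of L] unfolding Leq' by simp
    ultimately show ?thesis unfolding c_def by metis
  qed
qed

section \<open>Two colors\<close>

definition clique :: "(nat \<times> nat) set \<Rightarrow> nat set \<Rightarrow> bool" where
  "clique E Q \<longleftrightarrow> (\<forall>u\<in>Q. \<forall>v\<in>Q. u \<noteq> v \<longrightarrow> (u, v) \<in> E)"

text \<open>This is the invariant of the induction on \<open>k\<close>. With \<open>k + 1\<close>
  colors a \<open>k\<close>-clique leaves exactly one color free, and this forces the colors of the
  twins in a cone.\<close>

definition rigid :: "nat \<Rightarrow> nat set \<Rightarrow> (nat \<times> nat) set \<Rightarrow> bool" where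
  "rigid k V E \<longleftrightarrow>
     connected_graph V E \<and> locally_inferable k k V E \<and>
     (\<forall>v\<in>V. \<exists>Q\<subseteq>V. card Q = k \<and> clique E Q \<and> v \<in> Q) \<and>
     (\<forall>(u, v)\<in>E. \<exists>Q\<subseteq>V. card Q = k \<and> clique E Q \<and> u \<in> Q \<and> v \<in> Q)"

text \<open>Fixing the identifiers to \<open>1, ..., n\<close> and the inputs to rigid graphs only
  weakens the demand on the algorithm, so lower bounds carry over to
  \<open>online_solves\<close>.\<close>

definition solves :: "nat \<Rightarrow> nat \<Rightarrow> nat \<Rightarrow> online_alg \<Rightarrow> bool" where
  "solves k n T A \<longleftrightarrow>
     (\<forall>E vs. rigid k {1..n} E \<and> distinct vs \<and> set vs = {1..n} \<longrightarrow>
        proper_coloring (k + 1) {1..n} E (play (run A T) E vs))"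

lemma solves_if_online_solves:
  assumes "online_solves k k c n T A" "c \<ge> 1"
  shows "solves k n T A"
  unfolding solves_def
proof (intro allI impI)
  fix E vs
  assume A: "rigid k {1..n} E \<and> distinct vs \<and> set vs = {1..n}"
  have "n \<le> n ^ c" using assms(2) by (cases "n = 0") (auto intro: self_le_power)
  then have V: "finite {1..n} \<and> card {1..n} = n \<and> {1..n} \<subseteq> {1..n ^ c} \<and> connected_graph {1..n} E \<and>
      locally_inferable k k {1..n} E \<and> distinct vs \<and> set vs = {1..n}"
    using A unfolding rigid_def by auto
  have len: "length vs = n" using A distinct_card[of vs] by simp
  have idx: "\<exists>i<n. v = vs ! i" if "v \<in> {1..n}" for v
    using that A len by (metis in_set_conv_nth)
  have out: "online_output A T E vs i = play (run A T) E vs (vs ! i)" if "i < n" for i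
    using online_output_eq_play[of vs i A T E] A len that by simp
  have S: "(\<forall>i<n. play (run A T) E vs (vs ! i) \<in> {1..k+1}) \<and>
      (\<forall>i<n. \<forall>j<n. (vs ! i, vs ! j) \<in> E \<longrightarrow> play (run A T) E vs (vs ! i) \<noteq> play (run A T) E vs (vs ! j))"
    using assms(1) V out unfolding online_solves_def by (metis (no_types, lifting))
  show "proper_coloring (k + 1) {1..n} E (play (run A T) E vs)"
    unfolding proper_coloring_def
  proof (intro conjI ballI)
    show "play (run A T) E vs v \<in> {1..k + 1}" if "v \<in> {1..n}" for v
      using S idx[OF that] by blast
    fix e assume "e \<in> E"
    moreover obtain u v where "e = (u, v)" by (cases e)
    ultimately show "case e of (u, v) \<Rightarrow> u \<in> {1..n} \<longrightarrow> v \<in> {1..n} \<longrightarrow>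
        play (run A T) E vs u \<noteq> play (run A T) E vs v"
      using S idx by auto metis
  qed
qed

lemma connected_graphI:
  assumes "r \<in> V" "sym E" "\<And>v. v \<in> V \<Longrightarrow> (v, r) \<in> E\<^sup>*"
  shows "connected_graph V E"
proof -
  have "E \<union> E\<inverse> = E" using assms(2) by (auto dest: symD)
  moreover have "(u, v) \<in> E\<^sup>*" if "u \<in> V" "v \<in> V" for u v
    using assms(3)[OF that(1)] assms(3)[OF that(2)] sym_rtrancl[OF assms(2)]
    by (meson rtrancl_trans symD)
  ultimately show ?thesis using assms(1) unfolding connected_graph_def by auto
qed

text \<open>Every edge switches both colorings. Along a walk from a root \<open>r\<close>, the nodes
  colored like \<open>r\<close> are therefore the same for \<open>c\<close> and \<open>c'\<close>,
  and the colorings are equal or swapped.\<close>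

lemma proper_two_coloring_unique:
  assumes "connected_graph V E" "V \<subseteq> S" "E \<subseteq> V \<times> V" "E \<subseteq> F"
    and c: "proper_coloring 2 S F c" "proper_coloring 2 S F c'"
  shows "\<exists>\<phi>. bij_betw \<phi> {1..2::nat} {1..2} \<and> (\<forall>v\<in>V. c' v = \<phi> (c v))"
proof -
  obtain r where r: "r \<in> V" using assms(1) unfolding connected_graph_def by auto
  have col: "c v \<in> {1, 2}" "c' v \<in> {1, 2}" if "v \<in> V" for v
  proof -
    have "{1..2::nat} = {1, 2}" by auto
    then show "c v \<in> {1, 2}" "c' v \<in> {1, 2}"
      using c assms(2) that unfolding proper_coloring_def by blast+
  qed
  have edge1: "c u \<noteq> c v \<and> c' u \<noteq> c' v \<and> u \<in> V \<and> v \<in> V" if "(u, v) \<in> E" for u v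
  proof -
    have "(u, v) \<in> F" "u \<in> S" "v \<in> S" "u \<in> V" "v \<in> V" using that assms(2-4) by auto
    then show ?thesis using c unfolding proper_coloring_def by blast
  qed
  have edge: "c u \<noteq> c v \<and> c' u \<noteq> c' v \<and> u \<in> V \<and> v \<in> V" if "(u, v) \<in> E \<union> E\<inverse>" for u v
    using that edge1[of u v] edge1[of v u] by auto
  have eq: "c v = c r \<longleftrightarrow> c' v = c' r" if v: "v \<in> V" for v
  proof -
    have "(r, v) \<in> (E \<union> E\<inverse>)\<^sup>*" using assms(1) r v unfolding connected_graph_def by blast
    then have "v \<in> V \<and> (c v = c r \<longleftrightarrow> c' v = c' r)"
    proof induction
      case (step u v)
      then have "c u \<noteq> c v" "c' u \<noteq> c' v" "u \<in> V" "v \<in> V" "c u = c r \<longleftrightarrow> c' u = c' r"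
        using edge[of u v] by auto
      moreover have "x = z \<longleftrightarrow> y \<noteq> z" if "x \<in> {1, 2}" "y \<in> {1, 2}" "z \<in> {1, 2}" "x \<noteq> y" for x y z :: nat
        using that by auto
      ultimately show ?case using col r by metis
    qed (use r in simp)
    then show ?thesis ..
  qed
  define \<phi> where "\<phi> = (\<lambda>x::nat. if c r = c' r then x else 3 - x)"
  have "bij_betw \<phi> {1..2} {1..2}"
    by (rule bij_betw_byWitness[where f' = \<phi>]) (auto simp: \<phi>_def)
  moreover have "\<forall>v\<in>V. c' v = \<phi> (c v)"
  proof
    fix v assume v: "v \<in> V"
    have "y = (if a = b then x else 3 - x)"
      if "x \<in> {1, 2}" "y \<in> {1, 2}" "a \<in> {1, 2}" "b \<in> {1, 2}" "x = a \<longleftrightarrow> y = b" for x y a b :: nat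
      using that by auto
    from this[OF col(1,2)[OF v] col(1,2)[OF r] eq[OF v]] show "c' v = \<phi> (c v)" unfolding \<phi>_def .
  qed
  ultimately show ?thesis by blast
qed

text \<open>An edge is a 2-clique, and \<open>nb\<close> provides one at every node; uniqueness is
  that of 2-colorings of connected graphs.\<close>

lemma rigid_bipartite:
  fixes \<kappa> :: "nat \<Rightarrow> bool"
  assumes "graph V E" "connected_graph V E" "\<And>u v. (u, v) \<in> E \<Longrightarrow> \<kappa> u \<noteq> \<kappa> v"
    and nb: "\<And>v. v \<in> V \<Longrightarrow> \<exists>u. (v, u) \<in> E"
  shows "rigid 2 V E"
proof -
  have E: "E \<subseteq> V \<times> V" "sym E" "irrefl E" using assms(1) unfolding graph_def by auto
  have "k_partite 2 V E"
    unfolding k_partite_def proper_coloring_def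
    by (rule exI[of _ "\<lambda>v. if \<kappa> v then 1 else 2"]) (use assms(3) in auto)
  moreover have "\<exists>\<phi>. bij_betw \<phi> {1..2} {1..2} \<and> (\<forall>v\<in>V'. c' v = \<phi> (c v))"
    if "V' \<subseteq> V \<and> E' \<subseteq> E \<inter> (V' \<times> V') \<and> connected_graph V' E'"
      "proper_coloring 2 (ball E V' 2) (induced_edges E (ball E V' 2)) c \<and>
       proper_coloring 2 (ball E V' 2) (induced_edges E (ball E V' 2)) c'" for V' E' c c'
  proof (rule proper_two_coloring_unique[of V' E'])
    show "V' \<subseteq> ball E V' 2" using ball_refl by blast
    then show "E' \<subseteq> induced_edges E (ball E V' 2)" using that(1) unfolding induced_edges_def by auto
  qed (use that in auto)
  ultimately have "locally_inferable 2 2 V E"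
    unfolding locally_inferable_def using assms(1) by blast
  moreover have cl: "\<exists>Q\<subseteq>V. card Q = 2 \<and> clique E Q \<and> u \<in> Q \<and> v \<in> Q" if "(u, v) \<in> E" for u v
  proof (intro exI conjI)
    show "{u, v} \<subseteq> V" using that E(1) by auto
    have "u \<noteq> v" using that E(3) by (auto dest: irreflD)
    then show "card {u, v} = 2" by simp
    show "clique E {u, v}" using that symD[OF E(2) that] unfolding clique_def by auto
  qed auto
  moreover have "\<exists>Q\<subseteq>V. card Q = 2 \<and> clique E Q \<and> v \<in> Q" if "v \<in> V" for v
    using nb[OF that] cl by meson
  ultimately show ?thesis
    unfolding rigid_def using assms(2) by auto
qed

section \<open>Grids over a path of columns\<close>

definition cell :: "nat \<Rightarrow> nat \<Rightarrow> nat \<Rightarrow> nat" where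
  "cell T t j = 3 + t * (T + 2) + j"

lemma cell_inject:
  assumes "j \<le> Suc T" "j' \<le> Suc T"
  shows "cell T t j = cell T t' j' \<longleftrightarrow> t = t' \<and> j = j'"
proof
  assume "cell T t j = cell T t' j'"
  then have eq: "j + t * (T + 2) = j' + t' * (T + 2)" unfolding cell_def by simp
  have "j < T + 2" "j' < T + 2" using assms by simp_all
  then have "(j + t * (T + 2)) div (T + 2) = t" "(j' + t' * (T + 2)) div (T + 2) = t'"
    by (metis add.commute add_cancel_left_left add_is_0 div_less div_mult_self3 zero_neq_numeral)+
  then show "t = t' \<and> j = j'" using eq by simp
qed simp

lemma cell_surj:
  assumes "3 \<le> v" "v < 3 + M * (T + 2)"
  obtains t j where "v = cell T t j" "t < M" "j \<le> Suc T"
proof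
  show "v = cell T ((v - 3) div (T + 2)) ((v - 3) mod (T + 2))" using assms unfolding cell_def by (metis add.assoc add.commute div_mult_mod_eq le_add_diff_inverse)
  show "(v - 3) div (T + 2) < M" using assms by (subst div_less_iff_less_mult) auto
  show "(v - 3) mod (T + 2) \<le> Suc T" using mod_less_divisor[of "T + 2" "v - 3"] by linarith
qed

lemma cell_bounds: "j \<le> Suc T \<Longrightarrow> 3 \<le> cell T t j"
    "t < M \<Longrightarrow> j \<le> Suc T \<Longrightarrow> cell T t j < 3 + M * (T + 2)"
proof -
  assume "t < M" "j \<le> Suc T"
  then have "Suc t * (T + 2) \<le> M * (T + 2)" by (intro mult_le_mono1) simp
  then show "cell T t j < 3 + M * (T + 2)" using \<open>j \<le> Suc T\<close> unfolding cell_def by simp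
qed (simp add: cell_def)

text \<open>This is the product of \<open>R\<close> with a vertical path of \<open>T + 2\<close>
  nodes. The columns are unbounded, so every \<open>R\<close> has a grid; \<open>tower\<close> cuts
  out finitely many. The identifiers 1 and 2 are kept for the collapsed top, hence the offset 3 in
  \<open>cell\<close>.\<close>

definition grid :: "nat \<Rightarrow> (nat \<times> nat) set \<Rightarrow> (nat \<times> nat) set" where
  "grid T R = {(cell T t j, cell T t' j') | t j t' j'. j \<le> Suc T \<and> j' \<le> Suc T \<and>
     (t = t' \<and> (j' = Suc j \<or> j = Suc j') \<or> j = j' \<and> (t, t') \<in> R)}"

lemma grid_iff:
  assumes "j \<le> Suc T"
  shows "(cell T t j, v) \<in> grid T R \<longleftrightarrow> (\<exists>t' j'. v = cell T t' j' \<and> j' \<le> Suc T \<and>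
     (t = t' \<and> (j' = Suc j \<or> j = Suc j') \<or> j = j' \<and> (t, t') \<in> R))"
proof
  assume "(cell T t j, v) \<in> grid T R"
  then obtain s i t' j' where s: "cell T t j = cell T s i" "v = cell T t' j'" "i \<le> Suc T" "j' \<le> Suc T"
    "s = t' \<and> (j' = Suc i \<or> i = Suc j') \<or> i = j' \<and> (s, t') \<in> R"
    unfolding grid_def by blast
  have "s = t" "i = j" using s(1) cell_inject[OF assms s(3)] by simp_all
  then show "\<exists>t' j'. v = cell T t' j' \<and> j' \<le> Suc T \<and>
     (t = t' \<and> (j' = Suc j \<or> j = Suc j') \<or> j = j' \<and> (t, t') \<in> R)" using s by blast
qed (use assms in \<open>unfold grid_def, blast\<close>)

text \<open>A step changes either the height or the column. So \<open>T\<close> steps from the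
  bottom row climb at most to height \<open>T\<close>, below the row where the collapsed top is
  attached, and they project to a walk in \<open>R\<close>.\<close>

lemma ball_grid:
  assumes "u \<in> ball (grid T R) ((\<lambda>t. cell T t 0) ` X) T"
  obtains t j where "u = cell T t j" "j \<le> T" "t \<in> ball R X T"
proof -
  have walk: "\<exists>t' j. u = cell T t' j \<and> j \<le> m \<and> t' \<in> ball R X m"
    if "(cell T t 0, u) \<in> grid T R ^^ m" "t \<in> X" "m \<le> T" for t m u
    using that
  proof (induction m arbitrary: u)
    case 0
    then show ?case using ball_refl by auto
  next
    case (Suc m)
    then obtain w where w: "(cell T t 0, w) \<in> grid T R ^^ m" "(w, u) \<in> grid T R" by auto
    then obtain s j where s: "w = cell T s j" "j \<le> m" "s \<in> ball R X m"
      using Suc.IH[of w] Suc.prems by auto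
    have "j \<le> Suc T" using s(2) Suc.prems(3) by simp
    then obtain t' j' where t': "u = cell T t' j'"
      "s = t' \<and> (j' = Suc j \<or> j = Suc j') \<or> j = j' \<and> (s, t') \<in> R"
      using w(2) unfolding s(1) grid_iff[OF \<open>j \<le> Suc T\<close>] by blast
    have "t' \<in> ball R X (Suc m)" "j' \<le> Suc m"
      using t'(2) s ball_Suc[OF s(3)] ball_mono[of X X m "Suc m" R] by auto
    then show ?case using t'(1) by blast
  qed
  obtain t m where "t \<in> X" "m \<le> T" "(cell T t 0, u) \<in> grid T R ^^ m" using assms unfolding ball_def by auto
  with walk[of t u m] obtain t' j where "u = cell T t' j" "j \<le> m" "t' \<in> ball R X m" by blast
  moreover have "ball R X m \<subseteq> ball R X T" using \<open>m \<le> T\<close> by (intro ball_mono) auto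
  ultimately show ?thesis using that[of t' j] \<open>m \<le> T\<close> by auto
qed

text \<open>This makes the bottom row of the grid a game to which \<open>forcing\<close>
  applies.\<close>

lemma local_above_grid:
  "local_above T N (\<lambda>R ws. run A T (grid T R) (map (\<lambda>t. cell T t 0) ws))"
  unfolding local_above_def
proof (intro allI impI, rule run_agree[symmetric])
  fix R R' :: "(nat \<times> nat) set" and ws u v
  assume A: "R \<subseteq> {N..} \<times> {N..} \<and> R' \<subseteq> {N..} \<times> {N..} \<and> set ws \<subseteq> {N..} \<and>
      (\<forall>u\<in>ball R (set ws) T. \<forall>v. (u, v) \<in> R \<longleftrightarrow> (u, v) \<in> R')"
  assume "u \<in> ball (grid T R) (set (map (\<lambda>t. cell T t 0) ws)) T"
  then obtain t j where t: "u = cell T t j" "j \<le> T" "t \<in> ball R (set ws) T"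
    using ball_grid[of u T R "set ws"] by auto
  then have "j \<le> Suc T" by simp
  then show "(u, v) \<in> grid T R \<longleftrightarrow> (u, v) \<in> grid T R'"
    using A t(3) unfolding t(1) by (simp add: grid_iff)
qed

section \<open>The drift of proper 3-colorings on ladders\<close>

definition sg :: "nat \<Rightarrow> nat \<Rightarrow> int" where
  "sg x y = (if y = x + 1 \<or> x = y + 2 then 1 else -1)"

lemma turn_eq_sg: "c x \<in> {1..3} \<Longrightarrow> c y \<in> {1..3} \<Longrightarrow> c x \<noteq> c y \<Longrightarrow> turn c x y = sg (c x) (c y)"
  unfolding turn_def sg_def by auto

text \<open>A cycle of length four has no winding in a triangle.\<close>

lemma sg_square:
  assumes "w \<in> {1..3}" "x \<in> {1..3}" "y \<in> {1..3}" "z \<in> {1..3}" "w \<noteq> x" "x \<noteq> z" "w \<noteq> y" "y \<noteq> z"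
  shows "sg w x + sg x z = sg w y + sg y z"
proof -
  have "w = 1 \<or> w = 2 \<or> w = 3" "x = 1 \<or> x = 2 \<or> x = 3" "y = 1 \<or> y = 2 \<or> y = 3" "z = 1 \<or> z = 2 \<or> z = 3"
    using assms(1-4) by auto
  then show ?thesis using assms(5-8) by (elim disjE) (simp_all add: sg_def)
qed

text \<open>\<open>f\<close> and \<open>g\<close> color two adjacent rows. By
  \<open>sg_square\<close> the drifts over one square differ by the signs of its two rungs; the sum
  telescopes to the first and the last rung.\<close>

lemma drift_parallel:
  assumes "\<And>t. t \<in> set xs \<Longrightarrow> f t \<in> {1..3} \<and> g t \<in> {1..3} \<and> f t \<noteq> g t"
    and "\<And>s t. (s, t) \<in> line xs \<Longrightarrow> f s \<noteq> f t \<and> g s \<noteq> g t"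
  shows "\<bar>drift f xs - drift g xs\<bar> \<le> 2"
proof -
  have "drift f xs - drift g xs = sg (f (hd xs)) (g (hd xs)) - sg (f (last xs)) (g (last xs))"
    if "xs \<noteq> []"
    using that assms
  proof (induction xs rule: line.induct)
    case (1 x y zs)
    have "turn f x y = sg (f x) (f y)" "turn g x y = sg (g x) (g y)"
      using 1(3)[of x] 1(3)[of y] 1(4)[of x y] by (auto intro!: turn_eq_sg)
    moreover have "sg (f x) (f y) + sg (f y) (g y) = sg (f x) (g x) + sg (g x) (g y)"
      using 1(3)[of x] 1(3)[of y] 1(4)[of x y] by (intro sg_square) auto
    moreover have "drift f (y # zs) - drift g (y # zs) = sg (f y) (g y) - sg (f (last (y # zs))) (g (last (y # zs)))"
      using 1 by auto
    ultimately show ?case by simp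
  qed auto
  then show ?thesis by (cases "xs = []") (auto simp: sg_def)
qed

text \<open>Steps to and fro between \<open>a\<close> and \<open>b\<close> cancel in pairs. This is
  the situation in the collapsed top row.\<close>

lemma drift_alternating:
  assumes "a \<in> {1..3}" "b \<in> {1..3}" "a \<noteq> b" "\<And>s t. (s, t) \<in> line xs \<Longrightarrow> q s \<noteq> q t"
  shows "\<bar>drift (\<lambda>t. if q t then a else b) xs\<bar> \<le> 1"
proof -
  let ?g = "\<lambda>t. if q t then a else b"
  have anti: "sg b a = - sg a b" using assms(1-3) unfolding sg_def by auto
  have "drift ?g xs = (if q (hd xs) = q (last xs) then 0 else sg (?g (hd xs)) (?g (last xs)))" if "xs \<noteq> []"
    using that assms(4)
  proof (induction xs rule: line.induct)
    case (1 x y zs)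
    have xy: "q x \<noteq> q y" using 1(3)[of x y] by simp
    have "turn ?g x y = sg (?g x) (?g y)" using assms(1-3) xy by (intro turn_eq_sg) auto
    moreover have "drift ?g (y # zs) = (if q y = q (last (y # zs)) then 0 else sg (?g y) (?g (last (y # zs))))"
      using 1 by auto
    ultimately show ?case using xy anti by auto
  qed auto
  then show ?thesis by (cases "xs = []") (auto simp: sg_def)
qed

text \<open>The top ends of the columns are collapsed to the adjacent nodes \<open>1\<close> and \<open>2\<close>, according to the
  parity \<open>q\<close> of the position of the column; superfluous identifiers become leaves at \<open>1\<close>.\<close>

definition tower_arcs :: "nat \<Rightarrow> nat \<Rightarrow> nat \<Rightarrow> (nat \<Rightarrow> bool) \<Rightarrow> (nat \<times> nat) set" where
  "tower_arcs T M n q =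
     {(cell T t (Suc T), if q t then 1 else 2) | t. t < M} \<union> {(2, 1)} \<union>
     {(v, 1) | v. 3 + M * (T + 2) \<le> v \<and> v \<le> n}"

definition tower :: "nat \<Rightarrow> nat \<Rightarrow> nat \<Rightarrow> (nat \<Rightarrow> bool) \<Rightarrow> (nat \<times> nat) set \<Rightarrow> (nat \<times> nat) set" where
  "tower T M n q R =
     grid T R \<inter> {3..<3 + M * (T + 2)} \<times> {3..<3 + M * (T + 2)} \<union>
     tower_arcs T M n q \<union> (tower_arcs T M n q)\<inverse>"

lemma sym_grid: "sym R \<Longrightarrow> sym (grid T R)"
  unfolding grid_def sym_def by blast

text \<open>The checkerboard coloring, with \<open>q\<close> as the parity of the columns, extends
  to the top: the top cells with \<open>q t\<close> are colored like node 2 and attached to node 1,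
  the others conversely, and the leaves are colored like node 2. Every column climbs to the edge
  between 1 and 2, which gives connectedness.\<close>

lemma rigid_tower:
  assumes R: "sym R" "\<And>s t. (s, t) \<in> R \<Longrightarrow> q s \<noteq> q t" and n: "3 + M * (T + 2) \<le> n"
  shows "rigid 2 {1..n} (tower T M n q R)"
proof -
  let ?E = "tower T M n q R"
  define \<kappa> where "\<kappa> = (\<lambda>v. if v = 1 then even T else if v = 2 \<or> 3 + M * (T + 2) \<le> v then odd T
    else q ((v - 3) div (T + 2)) \<longleftrightarrow> even ((v - 3) mod (T + 2)))"
  have \<kappa>_cell: "\<kappa> (cell T t j) \<longleftrightarrow> (q t \<longleftrightarrow> even j)" if "t < M" "j \<le> Suc T" for t j
  proof -
    have "cell T t j - 3 = j + t * (T + 2)" "3 \<le> cell T t j" "cell T t j < 3 + M * (T + 2)"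
      using cell_bounds(1)[OF that(2)] cell_bounds(2)[OF that] by (auto simp: cell_def)
    moreover have "(j + t * (T + 2)) div (T + 2) = t" "(j + t * (T + 2)) mod (T + 2) = j"
      using that(2) by (simp_all only: div_mult_self1 mod_mult_self1) simp_all
    ultimately show ?thesis unfolding \<kappa>_def by (simp del: add_2_eq_Suc')
  qed
  have sym: "sym ?E" using sym_grid[OF R(1), of T] unfolding tower_def sym_def by blast
  have arcs: "u \<in> {1..n} \<and> v \<in> {1..n} \<and> \<kappa> u \<noteq> \<kappa> v" if arc: "(u, v) \<in> tower_arcs T M n q" for u v
  proof -
    consider (top) t where "t < M" "u = cell T t (Suc T)" "v = (if q t then 1 else 2)" | "u = 2" "v = 1"
      | "3 + M * (T + 2) \<le> u" "u \<le> n" "v = 1" using arc unfolding tower_arcs_def by auto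
    then show ?thesis
    proof cases
      case top
      then have "3 \<le> u" "u < 3 + M * (T + 2)" using cell_bounds(1)[of "Suc T" T t] cell_bounds(2)[of t M "Suc T" T] by auto
      moreover have "\<kappa> u \<longleftrightarrow> (q t \<longleftrightarrow> odd T)" using \<kappa>_cell[of t "Suc T"] top by simp
      moreover have "\<kappa> v \<longleftrightarrow> (q t \<longleftrightarrow> even T)" using top unfolding \<kappa>_def by simp
      ultimately show ?thesis using n top(3) by auto
    qed (use n in \<open>auto simp: \<kappa>_def\<close>)
  qed
  have grid: "u \<in> {1..n} \<and> v \<in> {1..n} \<and> \<kappa> u \<noteq> \<kappa> v"
    if e: "(u, v) \<in> grid T R" "u \<in> {3..<3 + M * (T + 2)}" "v \<in> {3..<3 + M * (T + 2)}" for u v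
  proof -
    obtain t j where t: "u = cell T t j" "t < M" "j \<le> Suc T" using cell_surj[of u M T] e(2) by auto
    obtain s i where s: "v = cell T s i" "s < M" "i \<le> Suc T" using cell_surj[of v M T] e(3) by auto
    obtain t' j' where t': "v = cell T t' j'" "j' \<le> Suc T"
      "t = t' \<and> (j' = Suc j \<or> j = Suc j') \<or> j = j' \<and> (t, t') \<in> R"
      using e(1) unfolding t(1) grid_iff[OF t(3)] by blast
    have "s = t'" "i = j'" using s t' cell_inject by metis+
    then have "t' < M" "\<kappa> u \<noteq> \<kappa> v" using \<kappa>_cell[OF t(2,3)] \<kappa>_cell[OF s(2,3)] s t t' R(2)[of t t'] by auto
    then show ?thesis using e(2,3) n by auto
  qed
  have edge: "u \<in> {1..n} \<and> v \<in> {1..n} \<and> \<kappa> u \<noteq> \<kappa> v" if "(u, v) \<in> ?E" for u v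
    using that arcs[of u v] arcs[of v u] grid[of u v] unfolding tower_def by auto
  have graph: "graph {1..n} ?E"
    unfolding graph_def
  proof (intro conjI sym irreflI)
    show "?E \<subseteq> {1..n} \<times> {1..n}" using edge by auto
    show "(u, u) \<notin> ?E" for u using edge[of u u] by auto
  qed
  have arcE: "(u, v) \<in> ?E \<and> (v, u) \<in> ?E" if "(u, v) \<in> tower_arcs T M n q" for u v
    using that unfolding tower_def by auto
  have two: "(2, 1) \<in> ?E" "(1, 2) \<in> ?E" using arcE[of 2 1] unfolding tower_arcs_def by auto
  have leaf: "(v, 1) \<in> ?E" if "3 + M * (T + 2) \<le> v" "v \<le> n" for v
    using arcE[of v 1] that unfolding tower_arcs_def by auto
  have top: "(cell T t (Suc T), if q t then 1 else 2) \<in> ?E" if "t < M" for t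
    using arcE[of "cell T t (Suc T)" "if q t then 1 else 2"] that unfolding tower_arcs_def by blast
  have up: "(cell T t j, cell T t (Suc j)) \<in> ?E" if "t < M" "j \<le> T" for t j
  proof -
    have "cell T t j \<in> {3..<3 + M * (T + 2)}" "cell T t (Suc j) \<in> {3..<3 + M * (T + 2)}"
      using cell_bounds(1)[of _ T t] cell_bounds(2)[of t M _ T] that by auto
    moreover have "(cell T t j, cell T t (Suc j)) \<in> grid T R"
      using that grid_iff[of j T t "cell T t (Suc j)" R] by auto
    ultimately show ?thesis unfolding tower_def by simp
  qed
  have col: "(cell T t j, 1) \<in> ?E\<^sup>*" if "t < M" "j \<le> Suc T" for t j
    using that(2)
  proof (induction rule: inc_induct)
    case base
    show ?case
      using top[OF that(1)] two(1) by (cases "q t") (auto intro: converse_rtrancl_into_rtrancl)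
  next
    case (step i)
    then show ?case using up[of t i] that(1) by (meson Suc_le_mono less_Suc_eq_le converse_rtrancl_into_rtrancl)
  qed
  have cases: "v = 1 \<or> v = 2 \<or> (\<exists>t j. v = cell T t j \<and> t < M \<and> j \<le> Suc T) \<or> 3 + M * (T + 2) \<le> v \<and> v \<le> n"
    if "v \<in> {1..n}" for v
    using that cell_surj[of v M T] by (metis One_nat_def Suc_1 atLeastAtMost_iff le_SucE not_less_eq_eq numeral_3_eq_3 not_less)
  have "connected_graph {1..n} ?E"
  proof (rule connected_graphI[OF _ sym])
    show "1 \<in> {1..n}" using n by simp
    show "(v, 1) \<in> ?E\<^sup>*" if "v \<in> {1..n}" for v
      using cases[OF that] col two(1) leaf by (auto intro: r_into_rtrancl)
  qed
  moreover have "\<exists>u. (v, u) \<in> ?E" if "v \<in> {1..n}" for v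
  proof -
    have "\<exists>u. (cell T t j, u) \<in> ?E" if "t < M" "j \<le> Suc T" for t j
      using top[of t] up[of t j] that by (cases "j = Suc T") auto
    then show ?thesis using cases[OF that] two leaf by auto
  qed
  ultimately show ?thesis using graph edge by (intro rigid_bipartite[of _ _ \<kappa>]) auto
qed

text \<open>Otherwise the tower over a forced path of drift \<open>2 * T + 6\<close> fits into
  \<open>n\<close> nodes. From the bottom row to the collapsed one there are \<open>T + 2\<close>
  passages, each changing the drift by at most 2, and the collapsed row has drift at most 1: the
  total is only \<open>2 * T + 5\<close>.\<close>

lemma solves_2_bound:
  assumes "solves 2 n T A"
  shows "n < 3 + len T (2 * T + 6) * (T + 2)"
proof (rule ccontr)
  define M where "M = len T (2 * T + 6)"
  assume "\<not> ?thesis"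
  then have n: "3 + M * (T + 2) \<le> n" unfolding M_def by simp
  let ?p = "\<lambda>t. cell T t 0"
  define F where "F = (\<lambda>R ws. run A T (grid T R) (map ?p ws))"
  have "local_above T 0 F" unfolding F_def by (rule local_above_grid)
  from forcing[OF this, of "2 * T + 6"] obtain pre a mid b post ws
    where f: "forced T 0 M pre a mid b post ws"
      and d: "int (2 * T + 6) \<le> drift (play F (line (pre @ a @ mid @ b @ post)) ws) mid"
    unfolding M_def by blast
  define L where "L = pre @ a @ mid @ b @ post"
  have L: "distinct L" "set L = {..<M}" "distinct ws" "set ws \<subseteq> set L" "set mid \<subseteq> set ws"
    using f unfolding forced_def L_def by auto
  obtain q :: "nat \<Rightarrow> bool" where q: "\<And>s t. (s, t) \<in> line L \<Longrightarrow> q s \<noteq> q t"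
    using line_bipartite[OF L(1)] by blast
  define E where "E = tower T M n q (line L)"
  have "sym (line L)" by (rule symI) (rule sym_line)
  then have rigid: "rigid 2 {1..n} E" unfolding E_def using q n by (rule rigid_tower)
  \<comment> \<open>The bottom cells come first, in the order of the game; the remaining nodes
    follow and cannot influence those colors.\<close>
  define vs where "vs = map ?p ws @ filter (\<lambda>v. v \<notin> ?p ` set ws) [1..<Suc n]"
  have inj: "?p s = ?p t \<longleftrightarrow> s = t" for s t using cell_inject[of 0 T 0 s t] by simp
  have cell_in: "cell T t j \<in> {3..<3 + M * (T + 2)}" if "t < M" "j \<le> Suc T" for t j
    using cell_bounds(1)[OF that(2)] cell_bounds(2)[OF that] by auto
  have "set vs = {1..n}"
  proof -
    have "?p ` set ws \<subseteq> {1..n}" using cell_in[of _ 0] L(2,4) n by fastforce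
    then show ?thesis unfolding vs_def by auto
  qed
  moreover have "distinct vs"
    unfolding vs_def using L(3) inj by (auto simp: distinct_map inj_on_def)
  ultimately have proper: "proper_coloring 3 {1..n} E (play (run A T) E vs)"
    using assms rigid unfolding solves_def by simp
  define c where "c = play (run A T) E vs"
  have c_range: "c v \<in> {1..3}" if "v \<in> {1..n}" for v
    using proper that unfolding proper_coloring_def c_def by blast
  have E_sub: "u \<in> {1..n} \<and> v \<in> {1..n}" if "(u, v) \<in> E" for u v
    using rigid that unfolding rigid_def locally_inferable_def graph_def by blast
  have c_edge: "c u \<noteq> c v" if "(u, v) \<in> E" for u v
    using proper that E_sub[OF that] unfolding proper_coloring_def c_def by blast
  have c_play: "c (?p t) = play F (line L) ws t" if "t \<in> set ws" for t
  proof -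
    let ?us = "takeWhile (\<lambda>w. w \<noteq> t) ws @ [t]"
    have us: "set ?us \<subseteq> set ws" using that set_takeWhileD by fastforce
    have "takeWhile (\<lambda>w. w \<noteq> ?p t) vs = takeWhile (\<lambda>w. w \<noteq> ?p t) (map ?p ws)"
      unfolding vs_def using that by (intro takeWhile_append1[of "?p t"]) auto
    also have "\<dots> = map ?p (takeWhile (\<lambda>w. w \<noteq> t) ws)"
      unfolding takeWhile_map comp_def using inj by simp
    finally have "c (?p t) = run A T E (map ?p ?us)" unfolding c_def play_def by simp
    \<comment> \<open>The views do not distinguish the tower from the unbounded grid: they reach
      height \<open>T\<close> at most, whereas the additional edges touch cells only at height
      \<open>T + 1\<close>, and all columns in view belong to \<open>L\<close>.\<close>
    also have "\<dots> = run A T (grid T (line L)) (map ?p ?us)"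
    proof (rule run_agree)
      fix u v assume "u \<in> ball (grid T (line L)) (set (map ?p ?us)) T"
      then have "u \<in> ball (grid T (line L)) (?p ` set ?us) T" by simp
      then obtain s j where s: "u = cell T s j" "j \<le> T" "s \<in> ball (line L) (set ?us) T"
        by (rule ball_grid)
      have "ball (line L) (set ?us) T \<subseteq> set L"
      proof
        fix x assume "x \<in> ball (line L) (set ?us) T"
        then obtain y m where y: "y \<in> set ?us" "(y, x) \<in> line L ^^ m" unfolding ball_def by auto
        show "x \<in> set L"
        proof (cases m)
          case 0
          then show ?thesis using y us L(4) by auto
        next
          case (Suc m')
          then show ?thesis using y(2) line_subset[of L] by auto
        qed
      qed
      then have sM: "s < M" using s(3) L(2) by auto
      have jS: "j \<le> Suc T" using s(2) by simp
      have u3: "u \<in> {3..<3 + M * (T + 2)}" using cell_in[OF sM jS] s(1) by simp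
      have "(u, v) \<notin> tower_arcs T M n q" "(v, u) \<notin> tower_arcs T M n q"
        using u3 s(1,2) cell_inject[of j T "Suc T"] unfolding tower_arcs_def by auto
      moreover have "v \<in> {3..<3 + M * (T + 2)}" if e: "(u, v) \<in> grid T (line L)"
      proof -
        obtain t' j' where t': "v = cell T t' j'" "j' \<le> Suc T" "s = t' \<or> (s, t') \<in> line L"
          using e unfolding s(1) grid_iff[OF jS] by blast
        then have "t' < M" using sM line_subset[of L] L(2) by auto
        then show ?thesis using cell_in t' by simp
      qed
      ultimately show "(u, v) \<in> grid T (line L) \<longleftrightarrow> (u, v) \<in> E"
        using u3 unfolding E_def tower_def by blast
    qed
    also have "\<dots> = play F (line L) ws t" unfolding F_def play_def by simp
    finally show ?thesis .
  qed
  \<comment> \<open>\<open>f j\<close> is the coloring of row \<open>j\<close>. Row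
    \<open>T + 2\<close> is virtual: each column shows the color of node 1 or 2, to which its top is
    attached.\<close>
  define f where "f = (\<lambda>j t. if j = T + 2 then if q t then c 1 else c 2 else c (cell T t j))"
  have mid_line: "(s, t) \<in> line L" if "(s, t) \<in> line mid" for s t
    using that line_append_subset[of mid "pre @ a" "b @ post"] unfolding L_def by auto
  have mid_M: "t < M" if "t \<in> set mid" for t using that L by auto
  have c12: "c 1 \<in> {1..3}" "c 2 \<in> {1..3}" "c 2 \<noteq> c 1"
  proof -
    have "(2, 1) \<in> E" unfolding E_def tower_def tower_arcs_def by simp
    then show "c 2 \<noteq> c 1" by (rule c_edge)
    show "c 1 \<in> {1..3}" "c 2 \<in> {1..3}" using c_range n by auto
  qed
  have f_range: "f j t \<in> {1..3}" if "t \<in> set mid" "j \<le> T + 2" for j t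
  proof (cases "j = T + 2")
    case False
    then have "cell T t j \<in> {1..n}" using cell_in[of t j] mid_M that n by auto
    then show ?thesis using c_range False unfolding f_def by simp
  qed (use c12 in \<open>simp add: f_def\<close>)
  have f_hor: "f j s \<noteq> f j t" if st: "(s, t) \<in> line mid" and j: "j \<le> T + 2" for j s t
  proof (cases "j = T + 2")
    case True
    then show ?thesis using q[OF mid_line[OF st]] c12 unfolding f_def by auto
  next
    case False
    then have jS: "j \<le> Suc T" using j by simp
    have "s \<in> set mid" "t \<in> set mid" using st line_subset[of mid] by auto
    then have "cell T s j \<in> {3..<3 + M * (T + 2)}" "cell T t j \<in> {3..<3 + M * (T + 2)}"
      using cell_in mid_M jS by blast+
    moreover have "(cell T s j, cell T t j) \<in> grid T (line L)"
      using mid_line[OF st] jS unfolding grid_iff[OF jS] by blast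
    ultimately have "(cell T s j, cell T t j) \<in> E" unfolding E_def tower_def by blast
    then show ?thesis using c_edge False unfolding f_def by simp
  qed
  have f_ver: "f j t \<noteq> f (Suc j) t" if t: "t \<in> set mid" and j: "j \<le> T + 1" for j t
  proof (cases "j = T + 1")
    case True
    have "(cell T t (Suc T), if q t then 1 else 2) \<in> E"
      using mid_M[OF t] unfolding E_def tower_def tower_arcs_def by blast
    from c_edge[OF this] show ?thesis using True unfolding f_def by (cases "q t") simp_all
  next
    case False
    then have jS: "j \<le> Suc T" "Suc j \<le> Suc T" using j by simp_all
    have "(cell T t j, cell T t (Suc j)) \<in> grid T (line L)"
      using jS unfolding grid_iff[OF jS(1)] by blast
    then have "(cell T t j, cell T t (Suc j)) \<in> E"
      using cell_in[OF mid_M[OF t]] jS unfolding E_def tower_def by blast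
    then show ?thesis using c_edge False jS unfolding f_def by auto
  qed
  have "\<bar>drift (f 0) mid - drift (f j) mid\<bar> \<le> 2 * int j" if "j \<le> T + 2" for j
    using that
  proof (induction j)
    case (Suc j)
    have "\<bar>drift (f j) mid - drift (f (Suc j)) mid\<bar> \<le> 2"
      using Suc.prems f_range f_hor f_ver by (intro drift_parallel) auto
    then show ?case using Suc by auto
  qed simp
  from this[of "T + 2"] have "\<bar>drift (f 0) mid - drift (f (T + 2)) mid\<bar> \<le> 2 * int (T + 2)" by simp
  moreover have "\<bar>drift (f (T + 2)) mid\<bar> \<le> 1"
    unfolding f_def using drift_alternating[of "c 1" "c 2" mid q] c12 q[OF mid_line] by auto
  moreover have "drift (f 0) mid = drift (play F (line L) ws) mid"
    using c_play L(5) by (intro drift_cong) (auto simp: f_def)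
  ultimately show False using d unfolding L_def by simp
qed

lemma len_bound: "len T m \<le> 2 ^ m * (2 * T + 4)"
proof -
  \<comment> \<open>Adding 1 turns the recursion into a doubling.\<close>
  have "len T m + 1 = 2 ^ m * (2 * T + 4)" by (induction m) (simp_all add: algebra_simps)
  then show ?thesis by simp
qed

text \<open>Only the linearity of the exponent in \<open>T\<close> matters. Each factor
  \<open>T + 2\<close> is estimated by \<open>2 ^ (T + 1)\<close>, and a final factor 8 absorbs the
  summand 3.\<close>

lemma solves_2_exp_bound:
  assumes "solves 2 n T A"
  shows "n \<le> 2 ^ (4 * T + 12)"
proof -
  have "T + 2 \<le> 2 ^ (T + 1)" by (induction T) auto
  have "len T (2 * T + 6) * (T + 2) \<le> (2 ^ (2 * T + 6) * (2 * T + 4)) * (T + 2)"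
    by (intro mult_le_mono1 len_bound)
  also have "\<dots> = 2 ^ (2 * T + 7) * ((T + 2) * (T + 2))" by (simp add: algebra_simps power_add)
  also have "\<dots> \<le> 2 ^ (2 * T + 7) * (2 ^ (T + 1) * 2 ^ (T + 1))"
    using \<open>T + 2 \<le> 2 ^ (T + 1)\<close> by (intro mult_le_mono2 mult_le_mono)
  also have "\<dots> = 2 ^ (2 * T + 7 + (T + 1 + (T + 1)))" by (simp only: power_add)
  also have "2 * T + 7 + (T + 1 + (T + 1)) = 4 * T + 9" by simp
  finally have "n < 3 + 2 ^ (4 * T + 9)" using solves_2_bound[OF assms] by linarith
  moreover have "(2::nat) ^ (4 * T + 12) = 8 * 2 ^ (4 * T + 9)" "1 \<le> (2::nat) ^ (4 * T + 9)"
    by (simp_all add: power_add)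
  ultimately show ?thesis by linarith
qed

section \<open>Cones\<close>

text \<open>The nodes above \<open>n\<close> are twins of their projections. A node may have several
  twins, so every \<open>n' \<ge> 2 * n\<close> is a possible size of the cone.\<close>

definition proj :: "nat \<Rightarrow> nat \<Rightarrow> nat" where
  "proj n v = Suc ((v - 1) mod n)"

lemma proj_in: "1 \<le> n \<Longrightarrow> proj n v \<in> {1..n}"
  unfolding proj_def by (simp add: Suc_leI)

lemma proj_id: "v \<in> {1..n} \<Longrightarrow> proj n v = v"
  unfolding proj_def by (cases v) auto

lemma proj_add: "v \<in> {1..n} \<Longrightarrow> proj n (v + n) = v"
proof -
  assume v: "v \<in> {1..n}"
  then have "v + n - 1 = (v - 1) + n" by simp
  then have "proj n (v + n) = proj n v" unfolding proj_def by simp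
  then show ?thesis using proj_id[OF v] by simp
qed

text \<open>Every node \<open>j > n\<close> is joined to the closed neighborhood of \<open>proj n j\<close>.\<close>

definition cone :: "nat \<Rightarrow> nat \<Rightarrow> (nat \<times> nat) set \<Rightarrow> (nat \<times> nat) set" where
  "cone n n' E = {(a, b). a \<in> {1..n'} \<and> b \<in> {1..n'} \<and> (a \<le> n \<or> b \<le> n) \<and>
     ((proj n a, proj n b) \<in> E \<or> a \<noteq> b \<and> proj n a = proj n b)}"

lemma relpow_mono: "R \<subseteq> (S :: ('a \<times> 'a) set) \<Longrightarrow> R ^^ m \<subseteq> S ^^ m"
  by (induction m) (simp_all add: relcomp_mono)

lemma proper_coloring_induced:
  "proper_coloring k S (induced_edges E S) c \<longleftrightarrow>
     (\<forall>v\<in>S. c v \<in> {1..k}) \<and> (\<forall>u\<in>S. \<forall>v\<in>S. (u, v) \<in> E \<longrightarrow> c u \<noteq> c v)"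
  unfolding proper_coloring_def induced_edges_def by auto

text \<open>The twin color \<alpha> is moved to the last place, \<phi> acts on the other colors, and
  the last color is then moved to \<alpha>'.\<close>

lemma transposed_bij:
  assumes "bij_betw \<phi> {1..k} {1..k}" "\<alpha> \<in> {1..Suc k}" "\<alpha>' \<in> {1..Suc k}"
  shows "bij_betw (transpose \<alpha>' (Suc k) \<circ> \<phi>(Suc k := Suc k) \<circ> transpose \<alpha> (Suc k)) {1..Suc k} {1..Suc k}"
proof -
  have tr: "bij_betw (transpose a (Suc k)) {1..Suc k} {1..Suc k}" if "a \<in> {1..Suc k}" for a
    using that by (simp add: bij_betw_def)
  have "bij_betw (\<phi>(Suc k := Suc k)) {1..k} {1..k}"
    using assms(1) by (rule bij_betw_cong[THEN iffD1, rotated]) auto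
  then have "bij_betw (\<phi>(Suc k := Suc k)) ({1..k} \<union> {Suc k}) ({1..k} \<union> {(\<phi>(Suc k := Suc k)) (Suc k)})"
    by (intro notIn_Un_bij_betw) auto
  moreover have "{1..k} \<union> {Suc k} = {1..Suc k}" by auto
  ultimately have "bij_betw (\<phi>(Suc k := Suc k)) {1..Suc k} {1..Suc k}" by simp
  then show ?thesis using tr assms(2,3) by (metis bij_betw_trans)
qed

lemma transposed_coloring:
  assumes "proper_coloring (Suc k) S (induced_edges E S) c" "\<alpha> \<in> {1..Suc k}" "B \<subseteq> S" "F \<subseteq> E"
    and "\<And>x. x \<in> B \<Longrightarrow> c x \<noteq> \<alpha>"
  shows "proper_coloring k B (induced_edges F B) (transpose \<alpha> (Suc k) \<circ> c)"
  unfolding proper_coloring_induced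
proof (intro conjI ballI impI)
  have c: "c x \<in> {1..Suc k}" if "x \<in> S" for x
    using that assms(1) unfolding proper_coloring_induced by blast
  show "(transpose \<alpha> (Suc k) \<circ> c) x \<in> {1..k}" if "x \<in> B" for x
    using c[of x] that assms(2,3,5) by (auto simp: transpose_def le_Suc_eq)
  show "(transpose \<alpha> (Suc k) \<circ> c) x \<noteq> (transpose \<alpha> (Suc k) \<circ> c) y"
    if "x \<in> B" "y \<in> B" "(x, y) \<in> F" for x y
  proof -
    have "x \<in> S" "y \<in> S" "(x, y) \<in> E" using that assms(3,4) by auto
    then have "c x \<noteq> c y" using assms(1) unfolding proper_coloring_induced by blast
    then show ?thesis by (auto dest: transpose_eq_imp_eq)
  qed
qed

text \<open>A twin over a \<open>k\<close>-clique must take the color missing on that clique.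
  Cliques along edges pass this color on to all twins near the projection \<open>W\<close> of
  \<open>V'\<close>; removing it leaves a \<open>k\<close>-coloring of the base, to which local
  uniqueness applies. The radius grows by one because \<open>V'\<close> may contain twins, which are
  one step away from the base.\<close>

lemma rigid_cone:
  assumes rigid: "rigid k {1..n} E" and k: "k \<ge> 2" and n': "2 * n \<le> n'"
  shows "rigid (Suc k) {1..n'} (cone n n' E)"
proof -
  let ?C = "cone n n' E" and ?\<pi> = "proj n"
  have conn: "connected_graph {1..n} E" and inf: "locally_inferable k k {1..n} E"
    and clV: "\<And>v. v \<in> {1..n} \<Longrightarrow> \<exists>Q\<subseteq>{1..n}. card Q = k \<and> clique E Q \<and> v \<in> Q"
    and clE: "\<And>u v. (u, v) \<in> E \<Longrightarrow> \<exists>Q\<subseteq>{1..n}. card Q = k \<and> clique E Q \<and> u \<in> Q \<and> v \<in> Q"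
    using rigid unfolding rigid_def by auto
  have E: "E \<subseteq> {1..n} \<times> {1..n}" "sym E" "irrefl E" and part: "k_partite k {1..n} E"
    using inf unfolding locally_inferable_def graph_def by auto
  have n: "1 \<le> n" using conn unfolding connected_graph_def by auto
  note pin = proj_in[OF n] and pid = proj_id[of _ n] and padd = proj_add[of _ n]
  have symC: "sym ?C" using E(2) unfolding cone_def sym_def by auto
  have lift: "E \<subseteq> ?C"
  proof
    fix e assume e: "e \<in> E"
    obtain u v where uv: "e = (u, v)" by (cases e)
    then have "u \<in> {1..n}" "v \<in> {1..n}" using e E(1) by auto
    then show "e \<in> ?C" using e uv n' pid unfolding cone_def by auto
  qed
  have down: "(?\<pi> a, ?\<pi> b) \<in> E \<or> ?\<pi> a = ?\<pi> b" if "(a, b) \<in> ?C" for a b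
    using that unfolding cone_def by auto
  have to_base: "a = ?\<pi> a \<or> (a, ?\<pi> a) \<in> ?C" if "a \<in> {1..n'}" for a
    using that pin[of a] pid[OF pin[of a]] n' unfolding cone_def by auto
  have star: "(x, j) \<in> ?C" "(j, x) \<in> ?C"
    if "x \<in> {1..n}" "j \<in> {Suc n..n'}" "?\<pi> j = x \<or> (?\<pi> j, x) \<in> E" for x j
  proof -
    show "(j, x) \<in> ?C" using that pid[OF that(1)] n' unfolding cone_def by auto
    then show "(x, j) \<in> ?C" using symC by (auto dest: symD)
  qed
  have twin: "v + n \<in> {Suc n..n'}" if "v \<in> {1..n}" for v using that n' by auto
  have apex: "insert j Q \<subseteq> {1..n'} \<and> card (insert j Q) = Suc k \<and> clique ?C (insert j Q)"
    if Q: "Q \<subseteq> {1..n}" "card Q = k" "clique E Q" and j: "j \<in> {Suc n..n'}" "?\<pi> j \<in> Q" for Q j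
  proof -
    have "finite Q" using Q(1) finite_subset by blast
    moreover have "j \<notin> Q" using j Q(1) by auto
    moreover have "(x, j) \<in> ?C \<and> (j, x) \<in> ?C" if "x \<in> Q" for x
      using star[of x j] that Q(1,3) j unfolding clique_def by (metis subsetD)
    ultimately show ?thesis using Q j lift n' unfolding clique_def by auto
  qed
  have irrC: "(a, a) \<notin> ?C" for a using E(3) unfolding cone_def irrefl_def by auto
  have graphC: "graph {1..n'} ?C"
    using symC irrC unfolding graph_def irrefl_def cone_def by auto
  have connC: "connected_graph {1..n'} ?C"
  proof (rule connected_graphI[OF _ symC])
    show "1 \<in> {1..n'}" using n n' by simp
    fix v assume v: "v \<in> {1..n'}"
    have "E \<union> E\<inverse> = E" using E(2) by (auto dest: symD)
    then have "(?\<pi> v, 1) \<in> E\<^sup>*" using conn pin[of v] n unfolding connected_graph_def by auto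
    then have "(?\<pi> v, 1) \<in> ?C\<^sup>*" using rtrancl_mono[OF lift] by auto
    then show "(v, 1) \<in> ?C\<^sup>*" using to_base[OF v] by (metis converse_rtrancl_into_rtrancl)
  qed
  have partC: "k_partite (Suc k) {1..n'} ?C"
  proof -
    obtain c where c: "proper_coloring k {1..n} E c" using part unfolding k_partite_def by auto
    have "c v \<in> {1..k}" if "v \<in> {1..n}" for v using c that unfolding proper_coloring_def by blast
    moreover have "c u \<noteq> c v" if "(u, v) \<in> E" for u v
      using c that E(1) unfolding proper_coloring_def by blast
    ultimately have "proper_coloring (Suc k) {1..n'} ?C (\<lambda>v. if v \<le> n then c v else Suc k)"
      unfolding proper_coloring_def cone_def using pid by (fastforce split: if_splits)
    then show ?thesis unfolding k_partite_def by blast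
  qed
  have "\<exists>Q\<subseteq>{1..n'}. card Q = Suc k \<and> clique ?C Q \<and> v \<in> Q" if v: "v \<in> {1..n'}" for v
  proof -
    obtain Q where Q: "Q \<subseteq> {1..n}" "card Q = k" "clique E Q" "?\<pi> v \<in> Q"
      using clV[OF pin[of v]] by auto
    show ?thesis
    proof (cases "v \<le> n")
      case True
      then have "v \<in> {1..n}" using v by auto
      then show ?thesis using apex[OF Q(1-3) twin, of v] padd[of v] pid[of v] Q(4) by (metis insertCI)
    next
      case False
      then have "v \<in> {Suc n..n'}" using v by auto
      then show ?thesis using apex[OF Q(1-3) _ Q(4)] by blast
    qed
  qed
  moreover have "\<exists>Q\<subseteq>{1..n'}. card Q = Suc k \<and> clique ?C Q \<and> u \<in> Q \<and> v \<in> Q" if uv: "(u, v) \<in> ?C" for u v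
  proof -
    have "\<exists>Q\<subseteq>{1..n}. card Q = k \<and> clique E Q \<and> ?\<pi> u \<in> Q \<and> ?\<pi> v \<in> Q"
      using down[OF uv] clE clV[OF pin[of u]] by metis
    then obtain Q where Q: "Q \<subseteq> {1..n}" "card Q = k" "clique E Q" "?\<pi> u \<in> Q" "?\<pi> v \<in> Q" by auto
    have uv': "u \<in> {1..n'}" "v \<in> {1..n'}" "u \<le> n \<or> v \<le> n" using uv unfolding cone_def by auto
    consider "u \<in> {1..n}" "v \<in> {1..n}" | "u \<in> {1..n}" "v \<in> {Suc n..n'}" | "v \<in> {1..n}" "u \<in> {Suc n..n'}"
      using uv' by fastforce
    then show ?thesis
    proof cases
      case 1
      then show ?thesis using apex[OF Q(1-3) twin, of u] padd[of u] pid[of u] pid[of v] Q(4,5) by (metis insertCI)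
    next
      case 2
      then show ?thesis using apex[OF Q(1-3) _ Q(5)] pid[of u] Q(4) by (metis insertCI)
    next
      case 3
      then show ?thesis using apex[OF Q(1-3) _ Q(4)] pid[of v] Q(5) by (metis insertCI)
    qed
  qed
  moreover have "\<exists>\<Phi>. bij_betw \<Phi> {1..Suc k} {1..Suc k} \<and> (\<forall>v\<in>V'. c' v = \<Phi> (c v))"
    if V': "V' \<subseteq> {1..n'}" and E': "E' \<subseteq> ?C \<inter> (V' \<times> V')" and conn': "connected_graph V' E'"
      and c: "proper_coloring (Suc k) (ball ?C V' (Suc k)) (induced_edges ?C (ball ?C V' (Suc k))) c"
      and c': "proper_coloring (Suc k) (ball ?C V' (Suc k)) (induced_edges ?C (ball ?C V' (Suc k))) c'"
    for V' E' c c'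
  proof -
    define W where "W = ?\<pi> ` V'"
    define B where "B = ball ?C V' (Suc k)"
    have W: "W \<subseteq> {1..n}" using pin unfolding W_def by auto
    have ball_V: "ball E W m \<subseteq> {1..n}" for m
    proof
      fix x assume "x \<in> ball E W m"
      then obtain w i where w: "w \<in> W" "(w, x) \<in> E ^^ i" unfolding ball_def by auto
      then show "x \<in> {1..n}" using W E(1) by (cases i) auto
    qed
    have ball_lift: "x \<in> ball ?C V' (Suc m)" if x: "x \<in> ball E W m" for x m
    proof -
      obtain a i where a: "a \<in> V'" "i \<le> m" "(?\<pi> a, x) \<in> E ^^ i" using x unfolding ball_def W_def by auto
      have "(?\<pi> a, x) \<in> ?C ^^ i" using a(3) relpow_mono[OF lift] by blast
      then have "(a, x) \<in> ?C ^^ i \<or> (a, x) \<in> ?C ^^ Suc i"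
        using to_base[of a] a(1) V' by (metis relpow_Suc_I2 subsetD)
      then show ?thesis using a(1,2) unfolding ball_def by (metis (mono_tags, lifting) Suc_le_mono le_SucI mem_Collect_eq)
    qed
    have ball_B: "ball E W k \<subseteq> B" unfolding B_def using ball_lift by auto
    \<comment> \<open>Twins are considered over radius \<open>k' = k - 1\<close>: they are then at
      distance at most \<open>k + 1\<close> from \<open>V'\<close>, so they belong to
      \<open>B\<close>.\<close>
    obtain k' where k': "k = Suc k'" using k by (cases k) auto
    have ball_k': "ball E W k' \<subseteq> ball E W k" unfolding k' by (intro ball_mono) auto
    have star_B: "j \<in> B" if x: "x \<in> ball E W k'" and j: "j \<in> {Suc n..n'}" "?\<pi> j = x" for x j
      using ball_Suc[OF ball_lift[OF x] star(1)[of x j]] x ball_V j unfolding B_def k' by blast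
    have W_k': "W \<subseteq> ball E W k'" using ball_refl by blast
    have step: "(?\<pi> a, ?\<pi> b) \<in> (E \<inter> W \<times> W) \<union> Id" if "(a, b) \<in> E' \<union> E'\<inverse>" for a b
    proof -
      have "(a, b) \<in> ?C" "a \<in> V'" "b \<in> V'" using that E' symC by (auto dest: symD)
      then show ?thesis using down[of a b] unfolding W_def by auto
    qed
    have connW: "connected_graph W (E \<inter> W \<times> W)"
      unfolding connected_graph_def
    proof (intro conjI ballI)
      show "W \<noteq> {}" using conn' unfolding connected_graph_def W_def by auto
      fix u v assume "u \<in> W" "v \<in> W"
      then obtain a b where ab: "a \<in> V'" "b \<in> V'" "u = ?\<pi> a" "v = ?\<pi> b" unfolding W_def by auto
      have "(a, b) \<in> (E' \<union> E'\<inverse>)\<^sup>*" using conn' ab unfolding connected_graph_def by auto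
      then have "(?\<pi> a, ?\<pi> b) \<in> (E \<inter> W \<times> W)\<^sup>*"
      proof induction
        case (step b d)
        then show ?case using \<open>\<And>a b. (a, b) \<in> E' \<union> E'\<inverse> \<Longrightarrow> (?\<pi> a, ?\<pi> b) \<in> (E \<inter> W \<times> W) \<union> Id\<close>[of b d]
          by (auto intro: rtrancl_into_rtrancl)
      qed simp
      then show "(u, v) \<in> (E \<inter> W \<times> W \<union> (E \<inter> W \<times> W)\<inverse>)\<^sup>*"
        unfolding ab by (rule rtrancl_mono[THEN subsetD, rotated]) auto
    qed
    have apex_color: "\<exists>\<alpha>\<in>{1..Suc k}. (\<forall>x\<in>ball E W k. d x \<noteq> \<alpha>) \<and> (\<forall>a\<in>V'. n < a \<longrightarrow> d a = \<alpha>)"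
      if d: "proper_coloring (Suc k) B (induced_edges ?C B) d" for d
    proof -
      have d_in: "d x \<in> {1..Suc k}" if "x \<in> B" for x
        using d that unfolding proper_coloring_induced by blast
      have d_neq: "d x \<noteq> d y" if "x \<in> B" "y \<in> B" "(x, y) \<in> ?C" for x y
        using d that unfolding proper_coloring_induced by blast
      \<comment> \<open>A clique \<open>Q\<close> through \<open>x\<close> and \<open>y\<close> and
        both twins lie in \<open>B\<close>. \<open>Q\<close> uses \<open>k\<close> colors, which the
        twins avoid; different twin colors would add up to \<open>k + 2\<close> colors.\<close>
      have same: "d i = d j"
        if x: "x \<in> ball E W k'" "y \<in> ball E W k'" "x = y \<or> (x, y) \<in> E"
          and i: "i \<in> {Suc n..n'}" "?\<pi> i = x" and j: "j \<in> {Suc n..n'}" "?\<pi> j = y" for x y i j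
      proof (rule ccontr)
        assume neq: "d i \<noteq> d j"
        have "\<exists>Q\<subseteq>{1..n}. card Q = k \<and> clique E Q \<and> x \<in> Q \<and> y \<in> Q"
          using x clE[of x y] clV[of x] ball_V by blast
        then obtain Q where Q: "Q \<subseteq> {1..n}" "card Q = k" "clique E Q" "x \<in> Q" "y \<in> Q" by auto
        have fin: "finite Q" using Q(1) finite_subset by blast
        have "Q \<subseteq> ball E W k"
        proof
          fix z assume z: "z \<in> Q"
          show "z \<in> ball E W k"
          proof (cases "z = x")
            case False
            then have "(x, z) \<in> E" using Q(3,4) z unfolding clique_def by auto
            then show ?thesis using ball_Suc[OF x(1)] k' by simp
          qed (use x(1) ball_k' in auto)
        qed
        then have QB: "Q \<subseteq> B" using ball_B by auto
        have iB: "i \<in> B" "j \<in> B" using star_B x(1,2) i j by blast+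
        have cli: "clique ?C (insert i Q)" "clique ?C (insert j Q)"
          using apex[OF Q(1-3)] i j Q(4,5) by auto
        have inj: "inj_on d Q"
        proof (rule inj_onI, rule ccontr)
          fix x y assume xy: "x \<in> Q" "y \<in> Q" "d x = d y" "x \<noteq> y"
          then have "(x, y) \<in> ?C" using cli(1) unfolding clique_def by simp
          then show False using d_neq[of x y] QB xy by blast
        qed
        have out: "i \<notin> Q" "j \<notin> Q" using i(1) j(1) Q(1) by auto
        have "d l \<noteq> d q" if "l \<notin> Q" "l \<in> B" "clique ?C (insert l Q)" "q \<in> Q" for l q
        proof -
          have "l \<noteq> q" using that(1,4) by auto
          then have "(l, q) \<in> ?C" using that(3,4) unfolding clique_def by simp
          moreover have "q \<in> B" using that(4) QB by auto
          ultimately show ?thesis using d_neq that(2) by simp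
        qed
        from this[OF out(1) iB(1) cli(1)] this[OF out(2) iB(2) cli(2)]
        have "d i \<notin> d ` Q" "d j \<notin> d ` Q" by auto
        then have "card (insert (d i) (insert (d j) (d ` Q))) = Suc (Suc k)"
          using fin neq card_image[OF inj] Q(2) by simp
        moreover have "insert (d i) (insert (d j) (d ` Q)) \<subseteq> {1..Suc k}"
          using d_in QB iB by blast
        ultimately show False using card_mono[of "{1..Suc k}" "insert (d i) (insert (d j) (d ` Q))"] by simp
      qed
      have within: "d (?\<pi> a + n) = d (?\<pi> b + n)" if "a \<in> V'" "b \<in> V'" for a b
      proof -
        have "(a, b) \<in> (E' \<union> E'\<inverse>)\<^sup>*" using conn' that unfolding connected_graph_def by auto
        then show ?thesis
        proof induction
          case (step b e)
          have "?\<pi> b \<in> W \<and> ?\<pi> e \<in> W"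
            using step(2) E' unfolding W_def by auto
          moreover have "?\<pi> b = ?\<pi> e \<or> (?\<pi> b, ?\<pi> e) \<in> E"
            using \<open>\<And>a b. (a, b) \<in> E' \<union> E'\<inverse> \<Longrightarrow> (?\<pi> a, ?\<pi> b) \<in> (E \<inter> W \<times> W) \<union> Id\<close>[OF step(2)] by auto
          ultimately have "d (?\<pi> b + n) = d (?\<pi> e + n)"
            using W_k' twin[OF pin] padd[OF pin] by (intro same[of "?\<pi> b" "?\<pi> e"]) auto
          then show ?case using step by simp
        qed simp
      qed
      obtain a0 where a0: "a0 \<in> V'" using conn' unfolding connected_graph_def by auto
      define \<alpha> where "\<alpha> = d (?\<pi> a0 + n)"
      \<comment> \<open>From \<open>W\<close> the common twin color spreads along walks of
        \<open>E\<close> up to radius \<open>k'\<close>.\<close>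
      have spread: "d (x + n) = \<alpha>" if "(w, x) \<in> E ^^ m" "w \<in> W" "m \<le> k'" for w x m
        using that
      proof (induction m arbitrary: x)
        case 0
        then show ?case using within[OF _ a0] unfolding \<alpha>_def W_def by auto
      next
        case (Suc m)
        then obtain y where y: "(w, y) \<in> E ^^ m" "(y, x) \<in> E" by auto
        have b: "y \<in> ball E W k'" "x \<in> ball E W k'"
          using y(1) Suc.prems unfolding ball_def by (auto simp del: relpow.simps intro: Suc_leD)
        then have "y \<in> {1..n}" "x \<in> {1..n}" using ball_V by blast+
        then have "d (y + n) = d (x + n)"
          using y(2) b twin padd by (intro same[of y x]) auto
        then show ?case using Suc y(1) by simp
      qed
      have star_color: "d j = \<alpha>" if x: "x \<in> ball E W k'" and j: "j \<in> {Suc n..n'}" "?\<pi> j = x" for x j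
      proof -
        have "d (x + n) = \<alpha>" using x spread unfolding ball_def by blast
        moreover have "x \<in> {1..n}" using x ball_V by blast
        ultimately show ?thesis using same[of x x j "x + n"] x j twin[of x] padd[of x] by simp
      qed
      have a0': "?\<pi> a0 \<in> ball E W k'" using a0 W_k' unfolding W_def by auto
      show ?thesis
      proof (intro bexI[of _ \<alpha>] conjI ballI impI)
        show "\<alpha> \<in> {1..Suc k}"
          unfolding \<alpha>_def by (rule d_in, rule star_B[OF a0' twin[OF pin] padd[OF pin]])
        show "d a = \<alpha>" if "a \<in> V'" "n < a" for a
        proof (rule star_color)
          show "?\<pi> a \<in> ball E W k'" using that(1) W_k' unfolding W_def by blast
          show "a \<in> {Suc n..n'}" using that V' by auto
        qed simp
        fix x assume x: "x \<in> ball E W k"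
        have xV: "x \<in> {1..n}" using x ball_V by blast
        obtain w m where w: "w \<in> W" "m \<le> k" "(w, x) \<in> E ^^ m" using x unfolding ball_def by auto
        \<comment> \<open>The twin of a node \<open>x\<close> at radius \<open>k\<close> may lie
          outside \<open>B\<close>, but a predecessor \<open>y\<close> at radius \<open>k'\<close>
          has a twin in \<open>B\<close> that is joined to \<open>x\<close> too. This is where
          coning off whole closed neighborhoods pays.\<close>
        have "\<exists>y. y \<in> ball E W k' \<and> (y = x \<or> (y, x) \<in> E)"
        proof (cases m)
          case 0
          then show ?thesis using w W_k' by auto
        next
          case (Suc m')
          then obtain y where "(w, y) \<in> E ^^ m'" "(y, x) \<in> E" using w(3) by auto
          moreover have "m' \<le> k'" using w(2) Suc k' by simp
          ultimately show ?thesis using w(1) unfolding ball_def by blast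
        qed
        then obtain y where y: "y \<in> ball E W k'" "y = x \<or> (y, x) \<in> E" by auto
        have yV: "y \<in> {1..n}" using y(1) ball_V by blast
        have "d (y + n) = \<alpha>" using star_color[OF y(1) twin[OF yV] padd[OF yV]] .
        moreover have "(x, y + n) \<in> ?C" using star(1)[OF xV twin[OF yV]] padd[OF yV] y(2) by auto
        moreover have "y + n \<in> B" using star_B[OF y(1) twin[OF yV] padd[OF yV]] .
        ultimately show "d x \<noteq> \<alpha>" using d_neq[of x "y + n"] x ball_B by auto
      qed
    qed
    obtain \<alpha> where \<alpha>: "\<alpha> \<in> {1..Suc k}" "\<And>x. x \<in> ball E W k \<Longrightarrow> c x \<noteq> \<alpha>" "\<And>a. a \<in> V' \<Longrightarrow> n < a \<Longrightarrow> c a = \<alpha>"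
      using apex_color[of c] c unfolding B_def by blast
    obtain \<alpha>' where \<alpha>': "\<alpha>' \<in> {1..Suc k}" "\<And>x. x \<in> ball E W k \<Longrightarrow> c' x \<noteq> \<alpha>'" "\<And>a. a \<in> V' \<Longrightarrow> n < a \<Longrightarrow> c' a = \<alpha>'"
      using apex_color[of c'] c' unfolding B_def by blast
    let ?c = "transpose \<alpha> (Suc k) \<circ> c" and ?c' = "transpose \<alpha>' (Suc k) \<circ> c'"
    have "proper_coloring k (ball E W k) (induced_edges E (ball E W k)) ?c"
      using c[folded B_def] \<alpha>(1) ball_B lift \<alpha>(2) by (rule transposed_coloring)
    moreover have "proper_coloring k (ball E W k) (induced_edges E (ball E W k)) ?c'"
      using c'[folded B_def] \<alpha>'(1) ball_B lift \<alpha>'(2) by (rule transposed_coloring)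
    ultimately obtain \<phi> where \<phi>: "bij_betw \<phi> {1..k} {1..k}" "\<And>v. v \<in> W \<Longrightarrow> ?c' v = \<phi> (?c v)"
      using inf W connW unfolding locally_inferable_def by (metis (no_types, lifting) order_refl)
    let ?\<Phi> = "transpose \<alpha>' (Suc k) \<circ> \<phi>(Suc k := Suc k) \<circ> transpose \<alpha> (Suc k)"
    have "bij_betw ?\<Phi> {1..Suc k} {1..Suc k}" using \<phi>(1) \<alpha>(1) \<alpha>'(1) by (rule transposed_bij)
    moreover have "c' v = ?\<Phi> (c v)" if v: "v \<in> V'" for v
    proof (cases "n < v")
      case True
      then show ?thesis using \<alpha>(3)[OF v] \<alpha>'(3)[OF v] by simp
    next
      case False
      then have "?\<pi> v = v" using v V' pid by auto
      then have vW: "v \<in> W" using v unfolding W_def by force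
      then have "c v \<noteq> \<alpha>" using \<alpha>(2) ball_refl by blast
      then have "?c v \<noteq> Suc k" by (auto simp: transpose_eq_iff)
      then have "?\<Phi> (c v) = transpose \<alpha>' (Suc k) (?c' v)" using \<phi>(2)[OF vW] by simp
      then show ?thesis by simp
    qed
    ultimately show ?thesis by blast
  qed
  then have "locally_inferable (Suc k) (Suc k) {1..n'} ?C"
    unfolding locally_inferable_def using graphC partC by blast
  ultimately show ?thesis unfolding rigid_def using connC by blast
qed

section \<open>Algorithms on cones\<close>

text \<open>The twin \<open>v + n\<close>, whose color the simulation needs, comes directly after \<open>v\<close>.\<close>

definition fibre :: "nat \<Rightarrow> nat \<Rightarrow> nat \<Rightarrow> nat list" where
  "fibre n n' v = v # (v + n) # filter (\<lambda>j. proj n j = v) [Suc (2 * n)..<Suc n']"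

definition unfold_nodes :: "nat \<Rightarrow> nat \<Rightarrow> nat list \<Rightarrow> nat list" where
  "unfold_nodes n n' vs = concat (map (fibre n n') vs)"

lemma set_fibre:
  assumes "v \<in> {1..n}" "2 * n \<le> n'"
  shows "set (fibre n n' v) = {j \<in> {1..n'}. proj n j = v}"
proof -
  have "j = v \<or> j = v + n \<or> 2 * n < j" if j: "j \<in> {1..n'}" "proj n j = v" for j
  proof -
    consider "j \<in> {1..n}" | "j - n \<in> {1..n}" "j = (j - n) + n" | "2 * n < j" using j(1) by fastforce
    then show ?thesis
    proof cases
      case 2
      then have "proj n j = j - n" using proj_add[of "j - n" n] by simp
      then show ?thesis using j(2) 2 by simp
    qed (use proj_id[of j n] j(2) in auto)
  qed
  moreover have "proj n v = v" "proj n (v + n) = v" using proj_id proj_add assms(1) by auto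
  ultimately have iff: "j \<in> {1..n'} \<and> proj n j = v \<longleftrightarrow>
      j = v \<or> j = v + n \<or> 2 * n < j \<and> j \<le> n' \<and> proj n j = v" for j
    using assms by auto
  show ?thesis unfolding iff fibre_def by auto
qed

lemma distinct_fibre: "v \<in> {1..n} \<Longrightarrow> distinct (fibre n n' v)"
  unfolding fibre_def by auto

lemma set_unfold_nodes:
  assumes "set vs \<subseteq> {1..n}" "2 * n \<le> n'"
  shows "set (unfold_nodes n n' vs) = {j \<in> {1..n'}. proj n j \<in> set vs}"
proof -
  have "(\<Union>v\<in>set vs. set (fibre n n' v)) = (\<Union>v\<in>set vs. {j \<in> {1..n'}. proj n j = v})"
    using assms set_fibre by (intro SUP_cong) auto
  then show ?thesis unfolding unfold_nodes_def by auto
qed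

lemma distinct_unfold_nodes:
  assumes "distinct vs" "set vs \<subseteq> {1..n}" "2 * n \<le> n'"
  shows "distinct (unfold_nodes n n' vs)"
  using assms
proof (induction vs)
  case (Cons v vs)
  have "set (fibre n n' v) \<inter> set (unfold_nodes n n' vs) = {}"
    using Cons.prems set_fibre[of v n n'] set_unfold_nodes[of vs n n'] by auto
  moreover have "distinct (unfold_nodes n n' vs)" using Cons by auto
  ultimately show ?case
    using distinct_fibre[of v n n'] Cons.prems unfolding unfold_nodes_def by auto
qed (simp add: unfold_nodes_def)

text \<open>The simulation must know these histories when \<open>v\<close> is presented. They
  consist of the full fibres of the earlier nodes and, for the twin, of \<open>v\<close>
  itself.\<close>

lemma takeWhile_unfold_nodes:
  assumes "v \<in> set vs" "set vs \<subseteq> {1..n}" "2 * n \<le> n'"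
  shows "takeWhile (\<lambda>w. w \<noteq> v) (unfold_nodes n n' vs) = unfold_nodes n n' (takeWhile (\<lambda>w. w \<noteq> v) vs)"
    and "takeWhile (\<lambda>w. w \<noteq> v + n) (unfold_nodes n n' vs) = unfold_nodes n n' (takeWhile (\<lambda>w. w \<noteq> v) vs) @ [v]"
proof -
  have v: "v \<in> {1..n}" using assms by auto
  obtain ys zs where vs: "vs = ys @ v # zs" "v \<notin> set ys" using split_list_first[OF assms(1)] by auto
  have tw: "takeWhile (\<lambda>w. w \<noteq> v) vs = ys" using vs by (auto simp: takeWhile_tail)
  have vs': "unfold_nodes n n' vs = unfold_nodes n n' ys @ v # (v + n) #
      filter (\<lambda>j. proj n j = v) [Suc (2 * n)..<Suc n'] @ unfold_nodes n n' zs"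
    unfolding vs unfold_nodes_def fibre_def by simp
  have "set ys \<subseteq> {1..n}" using assms(2) vs(1) by auto
  then have notin: "v \<notin> set (unfold_nodes n n' ys)" "v + n \<notin> set (unfold_nodes n n' ys)"
    using set_unfold_nodes[of ys n n'] assms(3) proj_id[OF v] proj_add[OF v] vs(2) by auto
  show "takeWhile (\<lambda>w. w \<noteq> v) (unfold_nodes n n' vs) = unfold_nodes n n' (takeWhile (\<lambda>w. w \<noteq> v) vs)"
    unfolding tw vs' using notin(1) by (subst takeWhile_append2) auto
  show "takeWhile (\<lambda>w. w \<noteq> v + n) (unfold_nodes n n' vs) = unfold_nodes n n' (takeWhile (\<lambda>w. w \<noteq> v) vs) @ [v]"
    unfolding tw vs' using notin(2) v by (subst takeWhile_append2) auto
qed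

text \<open>A walk in the cone projects to a walk in \<open>E\<close> that is no longer, so the view
  lies over radius \<open>T\<close>; the edges leaving it end within radius \<open>T + 1\<close>.
  This costs one unit of locality.\<close>

lemma run_cone_induced:
  assumes "\<And>x. x \<in> set xs \<Longrightarrow> proj n x \<in> U"
  shows "run A T (cone n n' (induced_edges E (ball E U (Suc T)))) xs = run A T (cone n n' E) xs"
proof (rule run_agree)
  fix a b assume "a \<in> ball (cone n n' E) (set xs) T"
  then obtain x m where x: "x \<in> set xs" "m \<le> T" "(x, a) \<in> cone n n' E ^^ m" unfolding ball_def by auto
  have "proj n a \<in> ball E U m" if "(x, a) \<in> cone n n' E ^^ m" for m a
    using that
  proof (induction m arbitrary: a)
    case 0
    then show ?case using ball_refl assms x(1) by auto
  next
    case (Suc m)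
    then obtain y where y: "(x, y) \<in> cone n n' E ^^ m" "(y, a) \<in> cone n n' E" by auto
    have "(proj n y, proj n a) \<in> E \<or> proj n y = proj n a" using y(2) unfolding cone_def by auto
    moreover have "ball E U m \<subseteq> ball E U (Suc m)" by (intro ball_mono) auto
    ultimately show ?case using Suc.IH[OF y(1)] ball_Suc by (metis subsetD)
  qed
  from this[OF x(3)] have pa: "proj n a \<in> ball E U T" using ball_mono[of U U m T E] x(2) by auto
  then have "proj n a \<in> ball E U (Suc T)" using ball_mono[of U U T "Suc T" E] by auto
  then have "(proj n a, proj n b) \<in> E \<longleftrightarrow> (proj n a, proj n b) \<in> induced_edges E (ball E U (Suc T))"
    using ball_Suc[OF pa] unfolding induced_edges_def by auto
  then show "(a, b) \<in> cone n n' E \<longleftrightarrow> (a, b) \<in> cone n n' (induced_edges E (ball E U (Suc T)))"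
    unfolding cone_def by auto
qed

text \<open>A node colored with the excess color \<open>k + 2\<close> takes over the color of its twin \<open>v + n\<close>;
  no neighbor of \<open>v\<close> uses either of the two colors.\<close>

definition project_alg :: "nat \<Rightarrow> nat \<Rightarrow> nat \<Rightarrow> nat \<Rightarrow> online_alg \<Rightarrow> online_alg" where
  "project_alg k n n' T A = (\<lambda>pre B F.
     let v = last pre; h = unfold_nodes n n' (butlast pre); C = cone n n' F; a = run A T C (h @ [v])
     in if a \<noteq> k + 2 then a else run A T C (h @ [v, v + n]))"

lemma solves_project_alg:
  assumes A: "solves (Suc k) n' T A" and k: "k \<ge> 2" and n': "2 * n \<le> n'"
  shows "solves k n (Suc T) (project_alg k n n' T A)"
  unfolding solves_def
proof (intro allI impI)
  fix E vs
  assume "rigid k {1..n} E \<and> distinct vs \<and> set vs = {1..n}"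
  then have rigid: "rigid k {1..n} E" and vs: "distinct vs" "set vs = {1..n}" by auto
  let ?C = "cone n n' E" and ?us = "unfold_nodes n n' vs"
  let ?d = "play (run (project_alg k n n' T A) (Suc T)) E vs"
  define c where "c = play (run A T) ?C ?us"
  have n: "1 \<le> n" using rigid unfolding rigid_def connected_graph_def by auto
  have "set ?us = {1..n'}" using set_unfold_nodes[of vs n n'] vs(2) n' proj_in[OF n] by auto
  moreover have "distinct ?us" using distinct_unfold_nodes[of vs n n'] vs n' by auto
  ultimately have "proper_coloring (Suc k + 1) {1..n'} ?C c"
    using A rigid_cone[OF rigid k n'] unfolding solves_def c_def by blast
  then have c: "c x \<in> {1..k + 2}" if "x \<in> {1..n'}" for x
    using that unfolding proper_coloring_def by auto
  have c_neq: "c x \<noteq> c y" if "(x, y) \<in> ?C" for x y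
    using \<open>proper_coloring (Suc k + 1) {1..n'} ?C c\<close> that
    unfolding proper_coloring_def cone_def by blast
  have d: "?d v = (if c v \<noteq> k + 2 then c v else c (v + n))" if v: "v \<in> {1..n}" for v
  proof -
    let ?pre = "takeWhile (\<lambda>w. w \<noteq> v) vs" and ?F = "induced_edges E (ball E (set (takeWhile (\<lambda>w. w \<noteq> v) vs @ [v])) (Suc T))"
    let ?h = "unfold_nodes n n' ?pre"
    have pre: "set ?pre \<subseteq> {1..n}" using vs(2) set_takeWhileD by fastforce
    have v': "v \<in> set vs" using v vs(2) by simp
    have h: "proj n x \<in> set (?pre @ [v])" if "x \<in> set (?h @ [v, v + n])" for x
      using that set_unfold_nodes[OF pre n'] proj_id[OF v] proj_add[OF v] by auto
    have "run A T (cone n n' ?F) (?h @ [v]) = c v"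
      unfolding c_def play_def takeWhile_unfold_nodes(1)[OF v' _ n', unfolded vs(2), OF order_refl]
      by (rule run_cone_induced) (use h in auto)
    moreover have "run A T (cone n n' ?F) ((?h @ [v]) @ [v + n]) = c (v + n)"
      unfolding c_def play_def takeWhile_unfold_nodes(2)[OF v' _ n', unfolded vs(2), OF order_refl]
      by (rule run_cone_induced) (use h in auto)
    ultimately show ?thesis
      unfolding play_def by (subst run_def) (simp add: project_alg_def Let_def)
  qed
  have E: "u \<in> {1..n} \<and> v \<in> {1..n} \<and> (v, u) \<in> E" if "(u, v) \<in> E" for u v
  proof -
    have "graph {1..n} E" using rigid unfolding rigid_def locally_inferable_def by (elim conjE)
    then show ?thesis using that unfolding graph_def by (auto dest: symD)
  qed
  have in_n': "v \<in> {1..n'}" "v + n \<in> {1..n'}" if "v \<in> {1..n}" for v using that n' by auto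
  have twin: "(v, v + n) \<in> ?C" if "v \<in> {1..n}" for v
    using that in_n'[OF that] proj_id[OF that] proj_add[OF that] unfolding cone_def by auto
  have edges: "(u, v) \<in> ?C" "(u, v + n) \<in> ?C" "(u + n, v) \<in> ?C" if "(u, v) \<in> E" for u v
    using that E[OF that] in_n'[of u] in_n'[of v] proj_id[of u n] proj_id[of v n] proj_add[of u n] proj_add[of v n]
    unfolding cone_def by auto
  show "proper_coloring (k + 1) {1..n} E ?d"
    unfolding proper_coloring_def
  proof (intro conjI ballI)
    show "?d v \<in> {1..k + 1}" if v: "v \<in> {1..n}" for v
      using d[OF v] c[OF in_n'(1)[OF v]] c[OF in_n'(2)[OF v]] c_neq[OF twin[OF v]] by auto
    fix e assume "e \<in> E"
    moreover obtain u v where e: "e = (u, v)" by (cases e)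
    ultimately have uv: "(u, v) \<in> E" by simp
    \<comment> \<open>At most one of \<open>u\<close> and \<open>v\<close> has color
      \<open>k + 2\<close>, and the twin whose color replaces it is joined to the other
      node.\<close>
    have "?d u \<noteq> ?d v"
      using d[of u] d[of v] E[OF uv] edges[OF uv] c_neq by (metis (full_types))
    then show "case e of (u, v) \<Rightarrow> u \<in> {1..n} \<longrightarrow> v \<in> {1..n} \<longrightarrow> ?d u \<noteq> ?d v" using e by simp
  qed
qed

section \<open>Induction on the number of colors\<close>

lemma solves_exp_bound:
  assumes "k \<ge> 2"
  shows "\<exists>a b. \<forall>n T A. solves k n T A \<longrightarrow> n \<le> 2 ^ (a * T + b)"
  using assms
proof (induction k rule: dec_induct)
  case base
  show ?case using solves_2_exp_bound by blast
next
  case (step k)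
  then obtain a b where ab: "\<And>n T A. solves k n T A \<Longrightarrow> n \<le> 2 ^ (a * T + b)"
    using step.IH by blast
  \<comment> \<open>Going down to \<open>k\<close> halves the number of nodes and raises the
    locality by one. The shift contributes \<open>a\<close> to the exponent, and a factor 4 covers
    the halving with its rounding.\<close>
  have "n \<le> 2 ^ (a * T + (a + b + 2))" if A: "solves (Suc k) n T A" for n T A
  proof -
    have "n div 2 \<le> 2 ^ (a * Suc T + b)" using A step(1) by (intro ab[OF solves_project_alg]) auto
    moreover have "(2::nat) ^ (a * T + (a + b + 2)) = 4 * 2 ^ (a * Suc T + b)"
      by (simp add: power_add algebra_simps)
    moreover have "1 \<le> (2::nat) ^ (a * Suc T + b)" by simp
    ultimately show ?thesis by linarith
  qed
  then show ?case by blast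
qed

theorem theorem5:
  fixes k c :: nat
  assumes "k \<ge> 2" and "c \<ge> 1"
  shows "\<exists>\<epsilon>>0. \<exists>n0. \<forall>n\<ge>n0. \<forall>T A. online_solves k k c n T A \<longrightarrow> real T \<ge> \<epsilon> * ln (real n)"
proof -
  obtain a b where ab: "\<And>n T A. solves k n T A \<Longrightarrow> n \<le> 2 ^ (a * T + b)"
    using solves_exp_bound[OF assms(1)] by blast
  \<comment> \<open>From \<open>n0\<close> on, \<open>b\<close> is at most half of
    \<open>ln n\<close>, so the exponential bound gives \<open>ln n \<le> 2 * a * T\<close>; using
    \<open>a + 1\<close> keeps the denominator positive.\<close>
  define \<epsilon> where "\<epsilon> = 1 / (2 * (real a + 1))"
  define n0 where "n0 = nat \<lceil>exp (2 * real b)\<rceil> + 1"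
  have "real T \<ge> \<epsilon> * ln (real n)" if n: "n0 \<le> n" and A: "online_solves k k c n T A" for n T A
  proof -
    have "exp (2 * real b) \<le> real n" "1 \<le> n" using n unfolding n0_def by linarith+
    then have b: "2 * real b \<le> ln (real n)" by (simp add: ln_ge_iff)
    have "n \<le> 2 ^ (a * T + b)" using ab[OF solves_if_online_solves[OF A assms(2)]] .
    then have "real n \<le> 2 ^ (a * T + b)" by (metis of_nat_le_iff of_nat_numeral of_nat_power)
    then have "ln (real n) \<le> ln (2 ^ (a * T + b))" using \<open>1 \<le> n\<close> by simp
    also have "\<dots> = real (a * T + b) * ln 2" by (simp add: ln_realpow)
    also have "\<dots> \<le> real (a * T + b) * 1" using ln_2_less_1 by (intro mult_left_mono) auto
    finally have "ln (real n) \<le> 2 * (real a * real T)" using b by simp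
    also have "\<dots> \<le> 2 * (real a + 1) * real T" by (simp add: algebra_simps)
    finally show ?thesis unfolding \<epsilon>_def by (simp add: field_simps)
  qed
  moreover have "\<epsilon> > 0" unfolding \<epsilon>_def by simp
  ultimately show ?thesis by blast
qed

end
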